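(* Let $\lambda$ be a partition of an integer $n+1\geq 2$. Then for every $i\in \{1,\ldots, \ell(\lambda)\}$: \begin{align*} \tilde{b}^{\lambda}_{(n+1),(n+1)}&=(\lambda_i-1)\tilde{b}^{\lambda_{\downarrow{(\lambda_i)}}}_{(n),(n)}+\sum_{d=1}^{\lambda_i-2}\tilde{b}^{\lambda^{\uparrow{(\lambda_i-1-d,d)}}}_{(n),(n)}+2\sum_{j\ne i} \lambda_j \tilde{b}^{\lambda_{\downarrow{(\lambda_i, \lambda_j)}}}_{(n),(n)},\\ c^{\lambda}_{(n+1),(n+1)}&=\sum_{d=1}^{\lambda_i-2}c^{\lambda^{\uparrow{(\lambda_i-1-d,d)}}}_{(n),(n)}+\sum_{j\ne i} \lambda_j c^{\lambda_{\downarrow{(\lambda_i, \lambda_j)}}}_{(n),(n)}, \end{align*} where $j$ runs over $1\le j\le \ell(\lambda)$, $j\neq i$.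
   Context: Partition operations: $\lambda_{\downarrow(k)}$ replaces one part $k$ by $k-1$ (a part $0$ is discarded); $\lambda_{\downarrow(k,l)}$ removes a part $k$ and a part $l$ and adds a part $k+l-1$; $\lambda^{\uparrow(k,l)}$ removes a part $k+l+1$ and adds parts $k$ and $l$. $(m)$ is the one-part partition of $m$. For $\lambda\vdash m$, $c^\lambda_{(m),(m)}$ is the number of ways to write a fixed permutation of cycle type $\lambda$ in $S_m$ as an ordered product of two $m$-cycles. Let $f_\star=(1\widehat1)\cdots(m\widehat m)\in S_{2m}$ (acting on $\{1,\dots,m,\widehat1,\dots,\widehat m\}$), $B_m$ its centralizer in $S_{2m}$ (the hyperoctahedral group, of order $2^mm!$), and for $\mu\vdash m$ let $K_\mu$ be the double coset of $B_m$ consisting of all $\omega\in S_{2m}$ such that $f_\star\omega f_\star\omega^{-1}$ has cycle type $\mu\mu$ (each part of $\mu$ repeated twice). $b^\lambda_{(m),(m)}$ is the number of ways to write a fixed element of $K_\lambda$ as a product $\sigma_2\sigma_3$ with $\sigma_2,\sigma_3\in K_{(m)}$, and $\tilde b^\lambda_{(m),(m)}=b^\lambda_{(m),(m)}/(2^mm!)$. *)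

theory Defs
  imports Complex_Main "HOL-Library.Multiset" "HOL-Combinatorics.Permutations" "HOL-Combinatorics.Orbits"
begin

(* Partitions are multisets of positive naturals. *)

definition part_down1 :: "nat \<Rightarrow> nat multiset \<Rightarrow> nat multiset" where
  "part_down1 k lam = lam - {#k#} + (if k > 1 then {#k - 1#} else {#})"

definition part_down2 :: "nat \<Rightarrow> nat \<Rightarrow> nat multiset \<Rightarrow> nat multiset" where
  "part_down2 k l lam = lam - {#k#} - {#l#} + {#k + l - 1#}"

definition part_up :: "nat \<Rightarrow> nat \<Rightarrow> nat multiset \<Rightarrow> nat multiset" where
  "part_up k l lam = lam - {#k + l + 1#} + {#k#} + {#l#}"

definition cycle_type :: "(nat \<Rightarrow> nat) \<Rightarrow> nat set \<Rightarrow> nat multiset" where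
  "cycle_type p S = image_mset card (mset_set ((\<lambda>x. orbit p x) ` S))"

definition c_coef :: "nat multiset \<Rightarrow> nat" where
  "c_coef lam = (let m = sum_mset lam;
      pi = (SOME p. p permutes {..<m} \<and> cycle_type p {..<m} = lam)
    in card {(s1, s2). s1 permutes {..<m} \<and> s2 permutes {..<m} \<and>
                       cycle_type s1 {..<m} = {#m#} \<and> cycle_type s2 {..<m} = {#m#} \<and>
                       s1 \<circ> s2 = pi})"

(* f_star on {0..<2m}: pairs i with i+m (i < m), i.e. hat i = i + m *)
definition fstar :: "nat \<Rightarrow> nat \<Rightarrow> nat" where
  "fstar m x = (if x < m then x + m else if x < 2 * m then x - m else x)"

(* double coset K_mu of B_m in S_{2m} *)
definition Kset :: "nat \<Rightarrow> nat multiset \<Rightarrow> (nat \<Rightarrow> nat) set" where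
  "Kset m mu = {w. w permutes {..<2 * m} \<and>
      cycle_type (fstar m \<circ> w \<circ> fstar m \<circ> inv w) {..<2 * m} = mu + mu}"

definition b_coef :: "nat multiset \<Rightarrow> nat" where
  "b_coef lam = (let m = sum_mset lam; w0 = (SOME w. w \<in> Kset m lam)
    in card {(s2, s3). s2 \<in> Kset m {#m#} \<and> s3 \<in> Kset m {#m#} \<and> s2 \<circ> s3 = w0})"

definition bt_coef :: "nat multiset \<Rightarrow> real" where
  "bt_coef lam = real (b_coef lam) / (2 ^ sum_mset lam * fact (sum_mset lam))"

end

(* Encode a permutation s of m points by the perfect matching of 2m points that joins i to the hat of s i,
   and a coset w B_m by the matching w f w^-1 obtained from f = fstar m.  Both numbers then count the perfect
   matchings L that form a single 2m-cycle with each of two fixed matchings M and N; for c only matchings L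
   respecting the bipartition count.  The union of M and N consists of cycles of lengths 2 lambda_i.

   Fix a vertex x on the cycle of length 2 lambda_i and let y = L x.  Contracting the edge xy, that is
   deleting x and y and joining M x to M y and N x to N y, keeps the two single-cycle conditions.
   If y lies on another cycle, the two cycles merge.  If y lies on the cycle of x, this cycle is cut
   in two when x and y have opposite colours, and is just shortened when they have equal colours, which
   happens for lambda_i - 1 vertices y and only without the bipartition.  The factor 2 in front of the
   merging terms arises in the same way, from the two colours of y.

   The recursion itself shows by induction that the count depends on M and N only through lambda, so no
   conjugacy argument for matchings is needed. *)

theory Submission
  imports Defs
begin

section \<open>Cycle types\<close>

text \<open>Two matchings are fixed because a factorisation \<open>s1 \<circ> s2 = t\<close> has
  only one free factor. L encodes \<open>s1\<close>; that \<open>s1\<close> is a full cycle is the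
  condition on L and M, and that \<open>s2 = inv s1 \<circ> t\<close> is one is the condition on L
  and N. For double cosets the same holds up to the choice of w in its coset of B_m, and the 2^m m!
  choices are the normalisation of b.

  The ranges of summation come from counting vertices. With more than two vertices L shares no edge
  with M or N, so y is neither M x nor N x. On a cycle with 2k vertices this leaves k - 2 candidates
  of the opposite colour (none if k = 1), and a cycle with 2l vertices has l of each colour.

  The obstacle is the colouring. It exists because the union of two matchings consists of even
  cycles, and it turns the type of the pair into the cycle type of \<open>M \<circ> N\<close> on one
  class, but it is not canonical. Contracting an edge between equal colours destroys it. A colouring
  of the contracted pair is then found by exchanging the colours on an arc or on a whole cycle,
  which the unrestricted count does not notice.\<close>

lemma cyclic_onI_chain:
  assumes "0 < c" and step: "\<And>i. Suc i < c \<Longrightarrow> p (h i) = h (Suc i)" and last: "p (h (c - 1)) = h 0"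
  shows "cyclic_on p (h ` {..<c})"
proof -
  have pow: "(p ^^ i) (h 0) = h i" if "i < c" for i
    using that
  proof (induction i)
    case (Suc i)
    then show ?case using step[of i] by simp
  qed simp
  obtain c' where c': "c = Suc c'" using \<open>0 < c\<close> by (cases c) auto
  have "(p ^^ c) (h 0) = h 0"
    using pow[of c'] last c' by simp
  then have "orbit p (h 0) = {(p ^^ m) (h 0) |m. m < c}"
    using \<open>0 < c\<close> by (rule orbit_altdef_bounded)
  also have "\<dots> = h ` {..<c}"
    using pow by (auto simp: image_iff) (metis pow)
  finally show ?thesis
    using \<open>0 < c\<close> unfolding cyclic_on_def by (intro bexI[of _ "h 0"]) auto
qed

lemma orbit_chain:
  assumes "p permutes S" "finite S"
  obtains h k where "0 < k" "card (orbit p x) = k" "bij_betw h {..<k} (orbit p x)"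
    "\<And>i. Suc i < k \<Longrightarrow> p (h i) = h (Suc i)" "p (h (k - 1)) = h 0" "h (0::nat) = x"
proof -
  have "permutation p" by (rule permutes_imp_permutation[OF assms(2,1)])
  then have self: "x \<in> orbit p x" by (rule permutation_self_in_orbit)
  define k where "k = funpow_dist1 p x x"
  define h where "h = (\<lambda>i. (p ^^ i) x)"
  have bij: "bij_betw h {..<k} (orbit p x)"
    unfolding bij_betw_def h_def k_def
    using inj_on_funpow_dist1[OF self] orbit_conv_funpow_dist1[OF self]
    by (simp add: atLeast0LessThan)
  have "(p ^^ k) x = x" unfolding k_def by (rule funpow_dist1_prop[OF self])
  moreover have "0 < k" by (simp add: k_def)
  ultimately have "p (h (k - 1)) = h 0"
    unfolding h_def by (cases k) auto
  then show thesis
    using that[of k h] bij_betw_same_card[OF bij] bij \<open>0 < k\<close> by (simp add: h_def)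
qed

lemma orbit_subset_invariant:
  assumes "p ` S \<subseteq> S" "x \<in> S"
  shows "orbit p x \<subseteq> S"
proof
  fix y assume "y \<in> orbit p x"
  then show "y \<in> S" by induct (use assms in auto)
qed

lemma cycle_type_empty [simp]: "cycle_type p {} = {#}"
  by (simp add: cycle_type_def)

lemma cycle_type_Un:
  assumes "finite S" "finite T" "S \<inter> T = {}" "p ` S \<subseteq> S" "p ` T \<subseteq> T"
  shows "cycle_type p (S \<union> T) = cycle_type p S + cycle_type p T"
proof -
  have "orbit p ` S \<inter> orbit p ` T = {}"
    using orbit_subset_invariant[OF assms(4)] orbit_subset_invariant[OF assms(5)] assms(3)
      orbit_nonempty[of p] by (smt (verit) Int_subset_iff disjoint_iff imageE subset_empty)
  then show ?thesis
    unfolding cycle_type_def image_Un using assms(1,2) by (simp add: mset_set_Union)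
qed

lemma cycle_type_cyclic:
  assumes "cyclic_on p C"
  shows "cycle_type p C = {#card C#}"
proof -
  have "orbit p ` C = {C}"
    using assms unfolding cyclic_on_alldef by blast
  then show ?thesis by (simp add: cycle_type_def)
qed

lemma cycle_type_cong:
  assumes "p ` S \<subseteq> S" "\<And>x. x \<in> S \<Longrightarrow> p x = q x"
  shows "cycle_type p S = cycle_type q S"
proof -
  have "orbit p x = orbit q x" if "x \<in> S" for x
    using that assms by (intro orbit_cong0[where A = S]) auto
  then show ?thesis by (simp add: cycle_type_def cong: image_cong)
qed

text \<open>An intertwining \<open>\<phi>\<close> carries orbits to orbits. It serves both for
  conjugation by a permutation and for the passage to the other colour class, where
  \<open>\<phi>\<close> is a matching and \<open>q\<close> an inverse.\<close>

lemma cycle_type_conj: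
  assumes "p permutes U" "finite U" "S \<subseteq> U" "p ` S \<subseteq> S" "inj_on \<phi> S" "\<And>x. x \<in> S \<Longrightarrow> q (\<phi> x) = \<phi> (p x)"
  shows "cycle_type q (\<phi> ` S) = cycle_type p S"
proof -
  have perm: "permutation p" by (rule permutes_imp_permutation[OF assms(2,1)])
  have sub: "orbit p x \<subseteq> S" if "x \<in> S" for x using that assms(4) by (rule orbit_subset_invariant[rotated])
  have orb: "orbit q (\<phi> x) = \<phi> ` orbit p x" if "x \<in> S" for x
    using orbit_inverse[OF permutation_self_in_orbit[OF perm], of x q \<phi>] sub[OF that] assms(6) by blast
  have "orbit q ` \<phi> ` S = (`) \<phi> ` orbit p ` S"
    using orb by (force simp: image_iff)
  moreover have "inj_on ((`) \<phi>) (orbit p ` S)"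
    using assms(5) sub inj_on_image_Pow[of \<phi> S] by (auto intro!: inj_on_subset[of _ "Pow S"])
  ultimately have eq: "mset_set (orbit q ` \<phi> ` S) = image_mset ((`) \<phi>) (mset_set (orbit p ` S))"
    by (simp add: image_mset_mset_set)
  have cd: "card (\<phi> ` T) = card T" if "T \<in># mset_set (orbit p ` S)" for T
  proof -
    have "T \<subseteq> S" using that sub by (cases "finite (orbit p ` S)") auto
    then show ?thesis using assms(5) by (meson card_image inj_on_subset)
  qed
  have "cycle_type q (\<phi> ` S) = image_mset (\<lambda>T. card (\<phi> ` T)) (mset_set (orbit p ` S))"
    unfolding cycle_type_def eq image_mset.compositionality comp_def ..
  also have "\<dots> = cycle_type p S"
    unfolding cycle_type_def by (rule image_mset_cong) (rule cd)
  finally show ?thesis .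
qed

lemma cycle_type_inv:
  assumes "p permutes U" "finite U"
  shows "cycle_type (inv p) S = cycle_type p S"
proof -
  have "permutation p" by (rule permutes_imp_permutation[OF assms(2,1)])
  then show ?thesis by (simp add: cycle_type_def orbit_inv_eq)
qed

text \<open>A part \<open>l\<close> is the size of an orbit, each of whose \<open>l\<close> points
  contributes \<open>G l\<close>. The factor lambda_j of the merging terms originates here.\<close>

lemma sum_mset_cycle_type:
  assumes "p permutes U" "finite U" "S \<subseteq> U" "p ` S \<subseteq> S"
  shows "(\<Sum>x\<in>S. G (card (orbit p x)) :: nat) = (\<Sum>l\<in>#cycle_type p S. l * G l)"
proof -
  have fin: "finite S" using assms finite_subset by blast
  have cyc: "cyclic_on p (orbit p x)" for x by (rule cyclic_on_orbit[OF assms(1,2)])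
  have sub: "orbit p x \<subseteq> S" if "x \<in> S" for x using that assms(4) by (rule orbit_subset_invariant[rotated])
  have self: "x \<in> orbit p x" for x
    by (rule permutation_self_in_orbit[OF permutes_imp_permutation[OF assms(2,1)]])
  have fib: "{x \<in> S. orbit p x = C} = C" if C: "C \<in> orbit p ` S" for C
  proof -
    obtain y where y: "y \<in> S" "C = orbit p y" using C by blast
    have "orbit p x = C \<longleftrightarrow> x \<in> C" for x
      using self[of x] orbit_cyclic_eq3[OF cyc[of y], of x] y by auto
    then show ?thesis using y sub[of y] by blast
  qed
  have "(\<Sum>x\<in>S. G (card (orbit p x))) = (\<Sum>C\<in>orbit p ` S. \<Sum>x\<in>{x\<in>S. orbit p x = C}. G (card (orbit p x)))"
    using fin by (rule sum.image_gen)
  also have "\<dots> = (\<Sum>C\<in>orbit p ` S. card C * G (card C))"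
  proof (rule sum.cong[OF refl])
    fix C assume "C \<in> orbit p ` S"
    have "(\<Sum>x\<in>{x\<in>S. orbit p x = C}. G (card (orbit p x))) = (\<Sum>x\<in>{x\<in>S. orbit p x = C}. G (card C))"
      by (rule sum.cong) auto
    then show "(\<Sum>x\<in>{x\<in>S. orbit p x = C}. G (card (orbit p x))) = card C * G (card C)"
      using fib[OF \<open>C \<in> _\<close>] by simp
  qed
  finally show ?thesis
    unfolding cycle_type_def image_mset.compositionality comp_def sum_unfold_sum_mset[of _ "orbit p ` S"] .
qed

lemma size_cycle_type_sum:
  assumes "p permutes U" "finite U" "S \<subseteq> U" "p ` S \<subseteq> S"
  shows "sum_mset (cycle_type p S) = card S"
  using sum_mset_cycle_type[OF assms, of "\<lambda>_. 1"] by simp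

lemma cycle_type_single_iff:
  assumes "p permutes U" "finite U" "S \<subseteq> U" "p ` S \<subseteq> S" "S \<noteq> {}"
  shows "cycle_type p S = {#card S#} \<longleftrightarrow> cyclic_on p S"
proof
  assume L: "cycle_type p S = {#card S#}"
  have fin: "finite S" using assms finite_subset by blast
  have sub: "orbit p x \<subseteq> S" if "x \<in> S" for x using that assms(4) by (rule orbit_subset_invariant[rotated])
  from \<open>S \<noteq> {}\<close> obtain x where x: "x \<in> S" by blast
  then have "card (orbit p x) \<in># cycle_type p S" using fin by (auto simp: cycle_type_def)
  then have "card (orbit p x) = card S" using L by simp
  then have "orbit p x = S" using sub[OF x] fin card_subset_eq by blast
  then show "cyclic_on p S" using x unfolding cyclic_on_def by blast
qed (rule cycle_type_cyclic)

section \<open>Pairs of perfect matchings\<close>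

text \<open>Through \<open>permutes\<close> a matching is the identity outside \<open>S\<close>, so
  equal edges mean equal functions and matchings can be counted as functions.\<close>

definition matching :: "'a set \<Rightarrow> ('a \<Rightarrow> 'a) \<Rightarrow> bool" where
  "matching S M \<longleftrightarrow> M permutes S \<and> (\<forall>z\<in>S. M z \<noteq> z \<and> M (M z) = z)"

text \<open>The union of the matchings \<^term>\<open>M\<close> and \<^term>\<open>L\<close> is a single cycle, stated as connectedness.\<close>

definition hamiltonian :: "'a set \<Rightarrow> ('a \<Rightarrow> 'a) \<Rightarrow> ('a \<Rightarrow> 'a) \<Rightarrow> bool" where
  "hamiltonian S M L \<longleftrightarrow> (\<forall>T\<subseteq>S. T \<noteq> {} \<longrightarrow> M ` T \<subseteq> T \<longrightarrow> L ` T \<subseteq> T \<longrightarrow> T = S)"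

text \<open>\<^term>\<open>x\<close> and \<^term>\<open>y\<close> become fixed points, so that the result is a permutation of the remaining points.\<close>

definition contract :: "'a \<Rightarrow> 'a \<Rightarrow> ('a \<Rightarrow> 'a) \<Rightarrow> 'a \<Rightarrow> 'a" where
  "contract x y M z =
    (if z = x \<or> z = y then z else if M z = x then M y else if M z = y then M x else M z)"

definition joint :: "('a \<Rightarrow> 'a \<Rightarrow> bool) \<Rightarrow> 'a set \<Rightarrow> ('a \<Rightarrow> 'a) \<Rightarrow> ('a \<Rightarrow> 'a) \<Rightarrow> ('a \<Rightarrow> 'a) set" where
  "joint R S M N =
    {L. matching S L \<and> hamiltonian S M L \<and> hamiltonian S N L \<and> (\<forall>z\<in>S. R z (L z))}"

lemma matchingI:
  assumes "\<And>z. z \<notin> S \<Longrightarrow> M z = z" "\<And>z. z \<in> S \<Longrightarrow> M z \<in> S \<and> M z \<noteq> z \<and> M (M z) = z"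
  shows "matching S M"
proof -
  have inv: "M (M z) = z" for z using assms by metis
  then have "\<exists>!x. M x = y" for y by metis
  then show ?thesis unfolding matching_def permutes_def using assms by auto
qed

lemma matching_permutes: "matching S M \<Longrightarrow> M permutes S"
  by (simp add: matching_def)

lemma matching_invol: "matching S M \<Longrightarrow> M (M z) = z"
  unfolding matching_def permutes_def by metis

lemma matching_mem: "matching S M \<Longrightarrow> M z \<in> S \<longleftrightarrow> z \<in> S"
  unfolding matching_def by (simp add: permutes_in_image)

lemma matching_neq: "matching S M \<Longrightarrow> z \<in> S \<Longrightarrow> M z \<noteq> z"
  unfolding matching_def by blast

lemma matching_outside: "matching S M \<Longrightarrow> z \<notin> S \<Longrightarrow> M z = z"
  unfolding matching_def permutes_def by blast

lemma matching_contract: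
  assumes M: "matching S M" and "x \<in> S" "y \<in> S" "x \<noteq> y" "M x \<noteq> y"
  shows "matching (S - {x, y}) (contract x y M)"
proof (rule matchingI)
  fix z assume "z \<notin> S - {x, y}"
  then show "contract x y M z = z"
    using matching_outside[OF M, of z] assms(2,3) by (auto simp: contract_def)
next
  fix z assume z: "z \<in> S - {x, y}"
  note facts = matching_mem[OF M] matching_neq[OF M] matching_invol[OF M]
  have "M y \<noteq> x" using assms(5) facts(3)[of y] by auto
  show "contract x y M z \<in> S - {x, y} \<and> contract x y M z \<noteq> z \<and> contract x y M (contract x y M z) = z"
  proof (cases "M z = x \<or> M z = y")
    case True
    then have "z = M x \<or> z = M y" using facts(3)[of z] by auto
    then show ?thesis
      using z assms(2-5) \<open>M y \<noteq> x\<close> facts by (auto simp: contract_def split: if_splits; metis)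
  next
    case False
    then show ?thesis using z facts by (auto simp: contract_def)
  qed
qed

text \<open>The sets closed under both matchings correspond to each other: remove \<open>x\<close>
  and \<open>y\<close> from such a set; conversely add both exactly when \<open>M x\<close> belongs
  to it. The removal leaves a nonempty set because \<open>x\<close> and \<open>y\<close> are not
  joined by \<open>M\<close>.\<close>

lemma hamiltonian_contract:
  assumes M: "matching S M" and L: "matching S L" and xy: "x \<in> S" "y \<in> S" "x \<noteq> y" "M x \<noteq> y" "L x = y"
  shows "hamiltonian (S - {x, y}) (contract x y M) (L(x := x, y := y)) \<longleftrightarrow> hamiltonian S M L"
proof
  note f = matching_mem[OF M] matching_neq[OF M] matching_invol[OF M]
  note g = matching_mem[OF L] matching_neq[OF L] matching_invol[OF L]
  have yx: "M y \<noteq> x" "L y = x" using xy f(3)[of y] g(3)[of x] by auto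
  show "hamiltonian S M L" if H: "hamiltonian (S - {x, y}) (contract x y M) (L(x := x, y := y))"
    unfolding hamiltonian_def
  proof (intro allI impI)
    fix T assume T: "T \<subseteq> S" "T \<noteq> {}" "M ` T \<subseteq> T" "L ` T \<subseteq> T"
    have xT: "x \<in> T \<longleftrightarrow> y \<in> T" using T(4) xy(5) yx(2) by (metis image_subset_iff)
    have ne: "T - {x, y} \<noteq> {}"
    proof
      assume "T - {x, y} = {}"
      then have "T = {x, y}" using xT T(2) by blast
      then have "M x \<in> {x, y}" using T(3) by blast
      then show False using xy f(2)[of x] by auto
    qed
    have "contract x y M z \<in> T - {x, y}" if "z \<in> T - {x, y}" for z
    proof -
      have zS: "z \<in> S - {x,y}" using that T(1) by blast
      have "contract x y M z \<notin> {x, y}"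
        using matching_mem[OF matching_contract[OF M xy(1-4)], of z] zS by blast
      moreover have "M w \<in> T" if "w \<in> T" for w
        using that T(3) by blast
      then have "contract x y M z \<in> T"
        using that xT unfolding contract_def by (metis Diff_iff)
      ultimately show ?thesis by blast
    qed
    moreover have "L z \<in> T - {x, y}" if "z \<in> T - {x, y}" for z
    proof -
      have "L z \<in> T" using that T(4) by blast
      moreover have "L z \<noteq> x" "L z \<noteq> y" using that xy(5) yx(2) g(3)[of z] by auto
      ultimately show ?thesis by blast
    qed
    ultimately have "T - {x, y} = S - {x, y}"
      using H ne T(1) unfolding hamiltonian_def by (auto simp: image_subset_iff Diff_mono)
    moreover from this have "M x \<in> T" using f xy by (metis Diff_iff empty_iff insert_iff)
    then have "x \<in> T" using T(3) f(3)[of x] by (metis image_subset_iff)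
    ultimately show "T = S" using xT xy by blast
  qed
  show "hamiltonian (S - {x, y}) (contract x y M) (L(x := x, y := y))" if H: "hamiltonian S M L"
    unfolding hamiltonian_def
  proof (intro allI impI)
    fix T' assume T': "T' \<subseteq> S - {x, y}" "T' \<noteq> {}" "contract x y M ` T' \<subseteq> T'" "(L(x := x, y := y)) ` T' \<subseteq> T'"
    define T where "T = (if M x \<in> T' then T' \<union> {x, y} else T')"
    have cx: "M y \<in> T'" if "M x \<in> T'"
    proof -
      have "contract x y M (M x) = M y" using xy f by (auto simp: contract_def)
      then show ?thesis using that T'(3) by (metis image_subset_iff)
    qed
    have cy: "M x \<in> T'" if "M y \<in> T'"
    proof -
      have "contract x y M (M y) = M x" using xy yx f by (auto simp: contract_def)
      then show ?thesis using that T'(3) by (metis image_subset_iff)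
    qed
    have "M z \<in> T" if "z \<in> T" for z
    proof (cases "z \<in> {x, y}")
      case True
      then show ?thesis using that T'(1) cx by (auto simp: T_def split: if_splits)
    next
      case False
      then have zT: "z \<in> T'" using that by (auto simp: T_def split: if_splits)
      show ?thesis
      proof (cases "M z \<in> {x, y}")
        case True
        then have "z = M x \<or> z = M y" using f(3)[of z] by auto
        then show ?thesis using True zT cx cy by (auto simp: T_def)
      next
        case 2: False
        then have "contract x y M z = M z" using False by (auto simp: contract_def)
        then show ?thesis using zT T'(3) by (auto simp: T_def image_subset_iff)
      qed
    qed
    moreover have "L z \<in> T" if "z \<in> T" for z
      using that T'(1,4) xy yx by (auto simp: T_def image_subset_iff split: if_splits)
    moreover have "T \<subseteq> S" "T \<noteq> {}" using T' xy by (auto simp: T_def)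
    ultimately have "T = S" using H unfolding hamiltonian_def by (simp add: image_subset_iff)
    then show "T' = S - {x, y}" using T'(1) xy unfolding T_def by (auto split: if_splits)
  qed
qed

text \<open>Matchings of the smaller set fix \<open>x\<close> and \<open>y\<close>, so deleting and
  inserting the edge are mutually inverse on whole functions.\<close>

lemma bij_betw_joint_contract:
  assumes M: "matching S M" and N: "matching S N" and xy: "x \<in> S" "y \<in> S" "x \<noteq> y" "M x \<noteq> y" "N x \<noteq> y"
    and R: "R x y" "R y x"
  shows "bij_betw (\<lambda>L. L(x := x, y := y)) {L \<in> joint R S M N. L x = y}
    (joint R (S - {x, y}) (contract x y M) (contract x y N))"
proof (rule bij_betw_byWitness[where f' = "\<lambda>L. L(x := y, y := x)"])
  let ?f = "\<lambda>L. L(x := x, y := y)" and ?g = "\<lambda>L. L(x := y, y := x)"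
  let ?S = "S - {x, y}"
  have inv: "L y = x" if "matching S L" "L x = y" for L
    using matching_invol[OF that(1)] that(2) by metis
  show "\<forall>L\<in>{L \<in> joint R S M N. L x = y}. ?g (?f L) = L"
    using inv xy by (fastforce simp: joint_def fun_eq_iff)
  have out: "L x = x" "L y = y" if "matching ?S L" for L
    using matching_outside[OF that] by auto
  show "\<forall>L\<in>joint R ?S (contract x y M) (contract x y N). ?f (?g L) = L"
    using out xy by (fastforce simp: joint_def fun_eq_iff)
  show "?f ` {L \<in> joint R S M N. L x = y} \<subseteq> joint R ?S (contract x y M) (contract x y N)"
  proof (rule image_subsetI)
    fix L assume "L \<in> {L \<in> joint R S M N. L x = y}"
    then have L: "L \<in> joint R S M N" "L x = y" by auto
    then have m: "matching S L" by (simp add: joint_def)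
    have "L z \<notin> {x, y}" if "z \<notin> {x, y}" for z
      using that m L(2) inv by (metis insert_iff matching_invol singletonD)
    then have "matching ?S (?f L)"
      using matching_outside[OF m] matching_mem[OF m] matching_neq[OF m] matching_invol[OF m]
      by (intro matchingI) auto
    moreover have "hamiltonian ?S (contract x y M) (?f L)" "hamiltonian ?S (contract x y N) (?f L)"
      using hamiltonian_contract[OF M m xy(1-4)] hamiltonian_contract[OF N m xy(1-3,5)] L
      by (auto simp: joint_def)
    moreover have "\<forall>z\<in>?S. R z ((?f L) z)" using L by (auto simp: joint_def)
    ultimately show "?f L \<in> joint R ?S (contract x y M) (contract x y N)"
      unfolding joint_def by simp
  qed
  show "?g ` joint R ?S (contract x y M) (contract x y N) \<subseteq> {L \<in> joint R S M N. L x = y}"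
  proof (rule image_subsetI)
    fix L assume L: "L \<in> joint R ?S (contract x y M) (contract x y N)"
    then have m: "matching ?S L" by (simp add: joint_def)
    have m': "matching S (?g L)"
    proof (rule matchingI)
      show "(?g L) z = z" if "z \<notin> S" for z using that xy matching_outside[OF m] by auto
      show "(?g L) z \<in> S \<and> (?g L) z \<noteq> z \<and> (?g L) ((?g L) z) = z" if "z \<in> S" for z
        using that xy matching_mem[OF m, of z] matching_neq[OF m, of z] matching_invol[OF m, of z] by auto
    qed
    have fg: "?f (?g L) = L" using out[OF m] xy by (auto simp: fun_eq_iff)
    have gx: "(?g L) x = y" using xy by auto
    have "hamiltonian S M (?g L)"
      by (rule iffD1[OF hamiltonian_contract[OF M m' xy(1-4) gx, unfolded fg]])
        (use L in \<open>simp add: joint_def\<close>)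
    moreover have "hamiltonian S N (?g L)"
      by (rule iffD1[OF hamiltonian_contract[OF N m' xy(1-3,5) gx, unfolded fg]])
        (use L in \<open>simp add: joint_def\<close>)
    moreover have "\<forall>z\<in>S. R z ((?g L) z)" using L R by (auto simp: joint_def)
    ultimately show "?g L \<in> {L \<in> joint R S M N. L x = y}" using m' gx by (simp add: joint_def)
  qed
qed

lemma finite_joint: "finite S \<Longrightarrow> finite (joint R S M N)"
  by (rule finite_subset[OF _ finite_permutations[of S]]) (auto simp: joint_def matching_def)

text \<open>A common edge would be a closed set of two vertices. With exactly two vertices
  \<open>L = M\<close> is forced; that case is the base of the induction.\<close>

lemma hamiltonian_no_common_edge:
  assumes "matching S M" "matching S L" "hamiltonian S M L" "x \<in> S" "2 < card S"
  shows "L x \<noteq> M x"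
proof
  assume eq: "L x = M x"
  have "M ` {x, M x} \<subseteq> {x, M x}" "L ` {x, M x} \<subseteq> {x, M x}" "{x, M x} \<subseteq> S"
    using eq matching_invol[OF assms(1), of x] matching_invol[OF assms(2), of x]
      matching_mem[OF assms(1), of x] assms(4) by auto
  then have "{x, M x} = S" using assms(3) unfolding hamiltonian_def by (metis insert_not_empty)
  moreover have "card {x, M x} \<le> 2" by (simp add: card_insert_if)
  ultimately show False using assms(5) by simp
qed

lemma card_joint_recursion:
  assumes "finite S" "2 < card S" and M: "matching S M" and N: "matching S N" and "x \<in> S"
    and R: "\<And>z w. R z w \<longleftrightarrow> R w z"
  shows "card (joint R S M N) = (\<Sum>y\<in>{y \<in> S - {x, M x, N x}. R x y}.
    card (joint R (S - {x, y}) (contract x y M) (contract x y N)))"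
proof -
  let ?Y = "{y \<in> S - {x, M x, N x}. R x y}"
  have fin: "finite (joint R S M N)" using assms(1) by (rule finite_joint)
  have im: "(\<lambda>L. L x) ` joint R S M N \<subseteq> ?Y"
  proof safe
    fix L assume "L \<in> joint R S M N"
    then have L: "matching S L" "hamiltonian S M L" "hamiltonian S N L" "R x (L x)"
      using assms(5) by (auto simp: joint_def)
    show "L x \<in> S" "L x = x \<Longrightarrow> False" "L x = M x \<Longrightarrow> False" "L x = N x \<Longrightarrow> False" "R x (L x)"
      using matching_mem[OF L(1)] matching_neq[OF L(1)] assms(5) L(4)
        hamiltonian_no_common_edge[OF M L(1,2) assms(5,2)] hamiltonian_no_common_edge[OF N L(1,3) assms(5,2)]
      by auto
  qed
  have "card (joint R S M N) = (\<Sum>y\<in>?Y. card {L \<in> joint R S M N. L x = y})"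
    unfolding card_eq_sum by (rule sum.group[OF fin _ im, symmetric]) (use assms(1) in simp)
  also have "\<dots> = (\<Sum>y\<in>?Y. card (joint R (S - {x, y}) (contract x y M) (contract x y N)))"
    using bij_betw_same_card[OF bij_betw_joint_contract[OF M N assms(5)]] R
    by (intro sum.cong) auto
  finally show ?thesis .
qed

section \<open>Properly coloured pairs\<close>

text \<open>The enumeration of the orbit is shifted so that it ends at \<open>x\<close>: deleting
  \<open>x\<close> then leaves its first \<open>k - 1\<close> entries.\<close>

lemma chain_permutes:
  assumes "p permutes S" "finite S"
  obtains h k where "0 < k" "card (orbit p x) = k" "bij_betw h {..<k} (orbit p x)"
    "\<And>i. Suc i < k \<Longrightarrow> p (h i) = h (Suc i)" "p (h (k - 1)) = h 0" "h (k - 1) = (x::'a)" "h (0::nat) = p x"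
proof -
  have perm: "permutation p" using assms by (rule permutes_imp_permutation[rotated])
  obtain h k where h: "0 < k" "card (orbit p (p x)) = k" "bij_betw h {..<k} (orbit p (p x))"
    "\<And>i. Suc i < k \<Longrightarrow> p (h i) = h (Suc i)" "p (h (k - 1)) = h 0" "h (0::nat) = p x"
    using orbit_chain[OF assms, of "p x"] by metis
  have "h (k - 1) = x"
    using h(5,6) permutes_inj[OF assms(1)] by (simp add: inj_eq)
  then show thesis
    using that[of k h] h by (simp add: permutation_orbit_step[OF perm])
qed

text \<open>The type of the pair is the cycle type of \<^term>\<open>M \<circ> N\<close> on the colour class \<^term>\<open>A\<close>: a cycle of the union
  of \<^term>\<open>M\<close> and \<^term>\<open>N\<close> with \<open>2k\<close> vertices meets \<^term>\<open>A\<close> in one orbit of size \<open>k\<close>.\<close>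

locale coloured_matchings =
  fixes S A :: "nat set" and M N :: "nat \<Rightarrow> nat"
  assumes fin: "finite S" and sub: "A \<subseteq> S" and M: "matching S M" and N: "matching S N"
    and Mcol: "z \<in> S \<Longrightarrow> M z \<in> A \<longleftrightarrow> z \<notin> A" and Ncol: "z \<in> S \<Longrightarrow> N z \<in> A \<longleftrightarrow> z \<notin> A"
begin

abbreviation p where "p \<equiv> M \<circ> N"

lemma finA: "finite A" using fin sub finite_subset by blast

lemma MM [simp]: "M (M z) = z" using M by (rule matching_invol)
lemma NN [simp]: "N (N z) = z" using N by (rule matching_invol)
lemma MS [simp]: "M z \<in> S \<longleftrightarrow> z \<in> S" using M by (rule matching_mem)
lemma NS [simp]: "N z \<in> S \<longleftrightarrow> z \<in> S" using N by (rule matching_mem)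
lemma M_eq [simp]: "M z = M w \<longleftrightarrow> z = w" by (metis MM)
lemma N_eq [simp]: "N z = N w \<longleftrightarrow> z = w" by (metis NN)

lemma perm: "p permutes S"
  using M N by (simp add: matching_permutes permutes_compose)

lemma permutation_p: "permutation p"
  using fin perm by (rule permutes_imp_permutation)

lemma inv_p: "inv p = N \<circ> M"
  by (rule inv_unique_comp) (auto simp: fun_eq_iff)

lemma pA: "z \<in> A \<Longrightarrow> p z \<in> A"
  using sub Mcol Ncol by auto

lemma p_image: "p ` A \<subseteq> A" using pA by blast

lemma orbit_sub: "x \<in> A \<Longrightarrow> orbit p x \<subseteq> A"
  by (rule orbit_subset_invariant[OF p_image])

lemma self_orbit: "x \<in> orbit p x"
  using permutation_p by (rule permutation_self_in_orbit)

lemma cyclic_orbit: "cyclic_on p (orbit p x)"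
  using perm fin by (rule cyclic_on_orbit)

lemma orbit_eq: "y \<in> orbit p x \<Longrightarrow> orbit p y = orbit p x"
  using cyclic_orbit by (rule orbit_cyclic_eq3)

lemma p_orbit_iff: "p y \<in> orbit p x \<longleftrightarrow> y \<in> orbit p x"
  using cyclic_on_f_in[OF perm cyclic_orbit] cyclic_on_inI[OF cyclic_orbit] by blast

lemma invariant_iff:
  assumes "T \<subseteq> A" "p ` T \<subseteq> T"
  shows "p y \<in> T \<longleftrightarrow> y \<in> T"
proof
  assume "p y \<in> T"
  then have "orbit p (p y) \<subseteq> T" using assms(2) by (intro orbit_subset_invariant)
  then show "y \<in> T" using self_orbit permutation_orbit_step[OF permutation_p] by blast
qed (use assms in blast)

lemma inj_on_M: "inj_on M T" by (simp add: inj_on_def)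

text \<open>\<open>M\<close> conjugates \<open>p\<close> to \<open>N \<circ> M\<close>, which is the
  inverse of \<open>p\<close> and has the same orbits.\<close>

lemma cycle_type_M_image:
  assumes "T \<subseteq> S" "p ` T \<subseteq> T"
  shows "cycle_type p (M ` T) = cycle_type p T"
proof -
  have "cycle_type (inv p) (M ` T) = cycle_type p T"
    by (rule cycle_type_conj[OF perm fin assms inj_on_M]) (simp add: inv_p)
  then show ?thesis by (simp add: cycle_type_inv[OF perm fin])
qed

lemma p_M_image:
  assumes "T \<subseteq> A" "p ` T \<subseteq> T"
  shows "p ` M ` T \<subseteq> M ` T"
proof safe
  fix z assume "z \<in> T"
  have "p (N (M z)) = z" by simp
  then have "N (M z) \<in> T" using invariant_iff[OF assms, of "N (M z)"] \<open>z \<in> T\<close> by metis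
  then show "p (M z) \<in> M ` T" by auto
qed

lemma S_eq: "S = A \<union> M ` A" "A \<inter> M ` A = {}"
proof -
  have "z \<in> M ` A" if "z \<in> S" "z \<notin> A" for z
    using that Mcol[of z] by (intro image_eqI[of _ _ "M z"]) auto
  then show "S = A \<union> M ` A" using sub by auto
  show "A \<inter> M ` A = {}" using Mcol sub by auto
qed

lemma card_S: "card S = 2 * card A"
proof -
  have "card S = card A + card (M ` A)"
    using S_eq finA card_Un_disjoint by (metis finite_imageI)
  also have "card (M ` A) = card A" by (rule card_image[OF inj_on_M])
  finally show ?thesis by simp
qed

text \<open>The two colour classes carry the same type. This is the source of the repeated parts in
  the definition of the double cosets.\<close>

lemma cycle_type_S: "cycle_type p S = cycle_type p A + cycle_type p A"
proof -
  have "cycle_type p (A \<union> M ` A) = cycle_type p A + cycle_type p (M ` A)"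
    using finA S_eq(2) p_image p_M_image[OF subset_refl p_image] by (intro cycle_type_Un) auto
  then show ?thesis using S_eq(1) cycle_type_M_image[OF sub p_image] by simp
qed

text \<open>A set closed under \<open>M\<close> and \<open>N\<close> consists of a
  \<open>p\<close>-closed part of \<open>A\<close> and its image under \<open>M\<close>;
  connectedness therefore means that \<open>p\<close> has a single orbit on
  \<open>A\<close>.\<close>

lemma hamiltonian_iff:
  assumes "A \<noteq> {}"
  shows "hamiltonian S M N \<longleftrightarrow> cycle_type p A = {#card A#}"
  unfolding cycle_type_single_iff[OF perm fin sub p_image assms]
proof
  assume H: "hamiltonian S M N"
  obtain x where x: "x \<in> A" using assms by blast
  let ?O = "orbit p x"
  have O: "?O \<subseteq> A" using x by (rule orbit_sub)
  have "N z \<in> M ` ?O" if "z \<in> ?O" for z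
    using that p_orbit_iff[of z x] by (intro image_eqI[of _ _ "p z"]) auto
  moreover have "N (M z) \<in> ?O" if "z \<in> ?O" for z
    using that p_orbit_iff[of "N (M z)" x] by simp
  ultimately have "N ` (?O \<union> M ` ?O) \<subseteq> ?O \<union> M ` ?O" by auto
  moreover have "M ` (?O \<union> M ` ?O) \<subseteq> ?O \<union> M ` ?O" by auto
  moreover have "?O \<union> M ` ?O \<subseteq> S" using O sub by auto
  moreover have "?O \<union> M ` ?O \<noteq> {}" using self_orbit by blast
  ultimately have "?O \<union> M ` ?O = S" using H unfolding hamiltonian_def by blast
  moreover have "M ` ?O \<inter> A = {}" using O S_eq(2) by blast
  ultimately have "A = ?O" using O sub by blast
  then show "cyclic_on p A" using x unfolding cyclic_on_def by blast
next
  assume C: "cyclic_on p A"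
  show "hamiltonian S M N"
    unfolding hamiltonian_def
  proof (intro allI impI)
    fix T assume T: "T \<subseteq> S" "T \<noteq> {}" "M ` T \<subseteq> T" "N ` T \<subseteq> T"
    obtain z where "z \<in> T" using T by blast
    then obtain x where x: "x \<in> T" "x \<in> A" using Mcol[of z] T(1,3) by blast
    have "orbit p x \<subseteq> T" using T(3,4) x(1) by (intro orbit_subset_invariant) auto
    moreover have "orbit p x = A" using C x(2) by (rule orbit_cyclic_eq3)
    ultimately have "A \<subseteq> T" "M ` A \<subseteq> T" using T(3) by auto
    then show "T = S" using T(1) S_eq(1) by blast
  qed
qed

text \<open>Together with its image under \<open>M\<close>, the set \<open>T\<close> is a union of
  cycles of the pair, and on each cycle the two colours may be exchanged independently of the
  others.\<close>

lemma flip: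
  assumes T: "T \<subseteq> A" "p ` T \<subseteq> T"
  shows "coloured_matchings S ((A - T) \<union> M ` T) M N"
    and "cycle_type p ((A - T) \<union> M ` T) = cycle_type p A"
proof -
  let ?A = "(A - T) \<union> M ` T"
  have TN: "N z \<in> M ` T \<longleftrightarrow> z \<in> T" for z
    using invariant_iff[OF T, of z] by (metis (mono_tags, lifting) MM comp_apply image_iff)
  have TM: "M z \<in> M ` T \<longleftrightarrow> z \<in> T" for z by auto
  have MT: "z \<in> M ` T \<longleftrightarrow> M z \<in> T" for z by (metis MM TM)
  have NT: "z \<in> M ` T \<longleftrightarrow> N z \<in> T" for z by (metis NN TN)
  show "coloured_matchings S ?A M N"
  proof
    show "?A \<subseteq> S" using sub T(1) by auto
    show "M z \<in> ?A \<longleftrightarrow> z \<notin> ?A" if "z \<in> S" for z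
      using Mcol[OF that] TM[of z] MT[of z] T(1) by blast
    show "N z \<in> ?A \<longleftrightarrow> z \<notin> ?A" if "z \<in> S" for z
      using Ncol[OF that] TN[of z] NT[of z] T(1) by blast
  qed (use fin M N in auto)
  have inv: "p ` (A - T) \<subseteq> A - T" using invariant_iff[OF T] pA by auto
  have "cycle_type p ((A - T) \<union> M ` T) = cycle_type p (A - T) + cycle_type p (M ` T)"
    using T S_eq(2) finA inv p_M_image[OF T] finite_subset[OF T(1)] by (intro cycle_type_Un) auto
  moreover have "cycle_type p ((A - T) \<union> T) = cycle_type p (A - T) + cycle_type p T"
    using T finA inv finite_subset[OF T(1)] by (intro cycle_type_Un) auto
  moreover have "(A - T) \<union> T = A" using T by blast
  moreover have "cycle_type p (M ` T) = cycle_type p T"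
    using T sub by (intro cycle_type_M_image) auto
  ultimately show "cycle_type p ?A = cycle_type p A" by simp
qed

lemma orbit_N: "card (orbit p (N y)) = card (orbit p y)"
proof -
  have "N ` orbit p y = orbit (inv p) (N y)"
    by (rule orbit_inverse[OF self_orbit]) (simp add: inv_p)
  then have "orbit p (N y) = N ` orbit p y" using orbit_inv_eq[OF permutation_p] by simp
  then show ?thesis by (simp add: card_image inj_on_def)
qed

lemma sum_type: "sum_mset (cycle_type p A) = card A"
  using size_cycle_type_sum[OF perm fin sub p_image] .

lemma cycle_type_split_orbit:
  assumes "x \<in> T" "T \<subseteq> A" "p ` T \<subseteq> T"
  shows "cycle_type p T = add_mset (card (orbit p x)) (cycle_type p (T - orbit p x))"
    and "p ` (T - orbit p x) \<subseteq> T - orbit p x"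
proof -
  have o: "orbit p x \<subseteq> T" using assms by (intro orbit_subset_invariant)
  show i: "p ` (T - orbit p x) \<subseteq> T - orbit p x" using assms(3) p_orbit_iff by blast
  have "p ` orbit p x \<subseteq> orbit p x" using p_orbit_iff by blast
  then have "cycle_type p (orbit p x \<union> (T - orbit p x))
      = cycle_type p (orbit p x) + cycle_type p (T - orbit p x)"
    using i o assms(2) finA by (intro cycle_type_Un) (auto dest: finite_subset)
  moreover have "orbit p x \<union> (T - orbit p x) = T" using o by blast
  ultimately show "cycle_type p T = add_mset (card (orbit p x)) (cycle_type p (T - orbit p x))"
    by (simp add: cycle_type_cyclic[OF cyclic_orbit])
qed

end

text \<open>By counting, \<open>A\<close> and its image under \<open>M\<close> fill
  \<open>S\<close>, and the conditions on \<open>N\<close> follow from those on \<open>M\<close>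
  because \<open>M \<circ> N\<close> permutes \<open>A\<close>. A candidate for a colour class is
  thus tested by closure, size and the edges of \<open>M\<close> alone.\<close>

lemma coloured_matchingsI:
  fixes A S :: "nat set"
  assumes "finite S" "A \<subseteq> S" and M: "matching S M" and N: "matching S N"
    and inv: "(M \<circ> N) ` A \<subseteq> A" and disj: "\<And>z. z \<in> A \<Longrightarrow> M z \<notin> A" and card: "card S = 2 * card A"
  shows "coloured_matchings S A M N"
proof -
  note Mm = matching_invol[OF M] matching_mem[OF M] and Nm = matching_invol[OF N] matching_mem[OF N]
  have injM: "inj_on M A" and injp: "inj_on (M \<circ> N) A"
    by (auto simp: inj_on_def) (metis Mm(1), metis Mm(1) Nm(1))
  have fA: "finite A" using assms finite_subset by blast
  have "A \<inter> M ` A = {}" using disj by blast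
  then have "card (A \<union> M ` A) = card S"
    using card card_image[OF injM] fA by (simp add: card_Un_disjoint)
  moreover have "A \<union> M ` A \<subseteq> S" using assms(2) Mm(2) by auto
  ultimately have S: "A \<union> M ` A = S" using assms(1) by (simp add: card_subset_eq)
  \<comment> \<open>An injective self-map of a finite set is onto. For \<open>z\<close> outside
    \<open>A\<close> this yields \<open>a\<close> in \<open>A\<close> with
    \<open>M z = M (N a)\<close>, that is \<open>N z = a\<close>.\<close>
  have surj: "(M \<circ> N) ` A = A" using endo_inj_surj[OF fA inv injp] .
  have Mc: "M z \<in> A \<longleftrightarrow> z \<notin> A" if "z \<in> S" for z
    using that S disj Mm(1) by (metis Un_iff image_iff)
  have N1: "N z \<notin> A" if "z \<in> A" for z
    using inv that disj Mm(1) by (metis comp_apply image_subset_iff)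
  have N2: "N z \<in> A" if zS: "z \<in> S" and zA: "z \<notin> A" for z
  proof -
    have "M z \<in> A" using Mc zS zA by blast
    then obtain a where a: "a \<in> A" "M z = M (N a)" using surj by (metis comp_apply image_iff)
    then have "z = N a" by (metis Mm(1))
    then show ?thesis using a Nm(1) by simp
  qed
  show ?thesis
    using assms(1,2) M N Mc N1 N2 by unfold_locales auto
qed

section \<open>Contracting an edge between the colours\<close>

text \<open>Empty lists are allowed to save case distinctions: the first list is empty when a fixed
  point \<open>x\<close> of \<open>p\<close> is deleted, or when no point follows \<open>y\<close>
  before the cycle returns to \<open>x\<close>.\<close>

lemma cyclic_on_concat:
  assumes "h ` {..<a} = X" "g ` {..<b} = Y" "0 < a + b"
    and h: "\<And>i. Suc i < a \<Longrightarrow> q (h i) = h (Suc i)" and g: "\<And>i. Suc i < b \<Longrightarrow> q (g i) = g (Suc i)"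
    and hg: "0 < a \<Longrightarrow> q (h (a - 1)) = (if b = 0 then h 0 else g 0)"
    and gh: "0 < b \<Longrightarrow> q (g (b - 1)) = (if a = 0 then g 0 else h 0)"
  shows "cyclic_on q (X \<union> Y)"
proof -
  define H where "H i = (if i < a then h i else g (i - a))" for i
  have "cyclic_on q (H ` {..<a + b})"
  proof (rule cyclic_onI_chain)
    fix i assume i: "Suc i < a + b"
    consider "Suc i < a" | "Suc i = a" "0 < b" | "a \<le> i" using i by linarith
    then show "q (H i) = H (Suc i)"
    proof cases
      case 1
      then show ?thesis using h by (simp add: H_def)
    next
      case 2
      then show ?thesis using hg by (auto simp: H_def)
    next
      case 3
      then show ?thesis using i g[of "i - a"] by (simp add: H_def Suc_diff_le)
    qed
  next
    show "q (H (a + b - 1)) = H 0"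
    proof (cases "b = 0")
      case True
      then show ?thesis using hg assms(3) by (simp add: H_def)
    next
      case False
      then have "a + b - 1 - a = b - 1" "\<not> a + b - 1 < a" by auto
      then show ?thesis using gh False by (simp add: H_def)
    qed
  qed (use assms in simp)
  also have "{..<a + b} = {..<a} \<union> (\<lambda>i. i + a) ` {..<b}"
    by (auto simp: lessThan_atLeast0 add.commute)
  also have "H ` ({..<a} \<union> (\<lambda>i. i + a) ` {..<b}) = h ` {..<a} \<union> g ` {..<b}"
  proof -
    have "H ` {..<a} = h ` {..<a}" by (rule image_cong) (auto simp: H_def)
    then show ?thesis by (simp add: image_Un image_image) (simp add: H_def)
  qed
  finally show ?thesis using assms(1,2) by simp
qed

context coloured_matchings
begin

definition cp where "cp x y = contract x y M \<circ> contract x y N"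

text \<open>On \<^term>\<open>A\<close>, contraction multiplies \<^term>\<open>p\<close> by the transposition of \<^term>\<open>x\<close> and \<^term>\<open>v\<close> and then
  skips \<^term>\<open>x\<close>.\<close>

lemma contract_opposite:
  assumes x: "x \<in> A" and v: "v \<in> A" "v \<noteq> x" "p v \<noteq> x"
  shows "coloured_matchings (S - {x, N v}) (A - {x}) (contract x (N v) M) (contract x (N v) N)"
    and "z \<in> A - {x} \<Longrightarrow> cp x (N v) z =
      (if z = v then if p x = x then p v else p x else if p z = x then p v else p z)"
proof -
  define y where "y = N v"
  have S: "x \<in> S" "v \<in> S" "y \<in> S" "y \<notin> A" using x v sub Ncol[of v] by (auto simp: y_def)
  have "M x \<noteq> y" using v(3) by (metis MM comp_apply y_def)
  moreover have "N x \<noteq> y" using v(2) by (simp add: y_def)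
  ultimately have ne: "x \<noteq> y" "M x \<noteq> y" "N x \<noteq> y" "N y \<noteq> x" "M y \<noteq> x"
    using S x v by (auto simp: y_def)
  have My: "M y \<in> A" "N y \<in> A" using S Mcol Ncol by auto
  have Mx: "M x \<notin> A" "N x \<notin> A" using S x Mcol Ncol by auto
  show "coloured_matchings (S - {x, N v}) (A - {x}) (contract x (N v) M) (contract x (N v) N)"
    unfolding y_def[symmetric]
  proof
    show "contract x y M z \<in> A - {x} \<longleftrightarrow> z \<notin> A - {x}" if "z \<in> S - {x, y}" for z
      using that x S ne My Mx Mcol[of z] unfolding contract_def by auto
    show "contract x y N z \<in> A - {x} \<longleftrightarrow> z \<notin> A - {x}" if "z \<in> S - {x, y}" for z
      using that x S ne My Mx Ncol[of z] unfolding contract_def by auto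
  qed (use fin sub S ne M N in \<open>auto intro: matching_contract\<close>)
  assume z: "z \<in> A - {x}"
  have zS: "z \<in> S" "N z \<notin> A" "z \<noteq> y" using z sub Ncol[of z] S by auto
  show "cp x (N v) z =
      (if z = v then if p x = x then p v else p x else if p z = x then p v else p z)"
  proof (cases "z = v")
    case True
    have "contract x y N z = N x" using True S ne x v by (auto simp: contract_def y_def)
    moreover have "contract x y M (N x) = (if p x = x then M y else p x)"
      using ne Mx x S Mcol[of "N x"] by (auto simp: contract_def)
    ultimately show ?thesis using True by (simp add: cp_def y_def[symmetric])
  next
    case False
    have "contract x y N z = N z" using False zS z x by (auto simp: contract_def y_def)
    moreover have "contract x y M (N z) = (if p z = x then M y else p z)"
      using False zS x S z Mcol[of "N z"] by (auto simp: contract_def) (auto simp: y_def)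
    ultimately show ?thesis using False by (simp add: cp_def y_def[symmetric])
  qed
qed

context
  notes comp_apply [simp del]
begin

lemma orbit_minus_last:
  fixes k :: nat
  assumes "bij_betw h {..<k} (orbit p x)" "0 < k" "h (k - 1) = x"
  shows "h ` {..<k - 1} = orbit p x - {x}"
proof -
  have "{..<k} = insert (k - 1) {..<k - 1}" using assms(2) by auto
  then have "orbit p x = insert x (h ` {..<k - 1})"
    using assms(1,3) by (simp add: bij_betw_def)
  moreover have "x \<notin> h ` {..<k - 1}"
    using assms unfolding bij_betw_def inj_on_def by fastforce
  ultimately show ?thesis by auto
qed

lemma finite_orbit_p: "finite (orbit p x)"
  using cyclic_orbit by (rule finite_cyclic_on)

lemma orbits_disjoint: "v \<notin> orbit p x \<Longrightarrow> orbit p x \<inter> orbit p v = {}"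
  using orbit_eq[of _ x] orbit_eq[of _ v] self_orbit[of v] by blast

text \<open>A transposition across two cycles merges them: the predecessor of \<open>x\<close> now
  goes to \<open>p v\<close>, and \<open>v\<close> goes to \<open>p x\<close>. The length is one
  less than the sum since \<open>x\<close> is skipped.\<close>

lemma cycle_type_join:
  assumes x: "x \<in> A" and v: "v \<in> A" "v \<notin> orbit p x"
  shows "cycle_type (cp x (N v)) (A - {x}) =
    part_down2 (card (orbit p x)) (card (orbit p v)) (cycle_type p A)"
proof -
  let ?q = "cp x (N v)"
  let ?R = "A - orbit p x - orbit p v"
  obtain h k where h: "0 < k" "card (orbit p x) = k" "bij_betw h {..<k} (orbit p x)"
    "\<And>i. Suc i < k \<Longrightarrow> p (h i) = h (Suc i)" "p (h (k - 1)) = h 0" "h (k - 1) = x" "h (0::nat) = p x"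
    using chain_permutes[OF perm fin, of x] by metis
  obtain g l where g: "0 < l" "card (orbit p v) = l" "bij_betw g {..<l} (orbit p v)"
    "\<And>i. Suc i < l \<Longrightarrow> p (g i) = g (Suc i)" "p (g (l - 1)) = g 0" "g (l - 1) = v" "g (0::nat) = p v"
    using chain_permutes[OF perm fin, of v] by metis
  have disj: "orbit p x \<inter> orbit p v = {}" using v(2) by (rule orbits_disjoint)
  have vx: "v \<noteq> x" "p v \<noteq> x"
    using v(2) self_orbit[of x] p_orbit_iff[of v x] by auto
  note q = contract_opposite(2)[OF x v(1) vx]
  have OA: "orbit p x \<subseteq> A" "orbit p v \<subseteq> A" using x v orbit_sub by auto
  have himg: "h ` {..<k - 1} = orbit p x - {x}" using orbit_minus_last h by blast
  have gimg: "g ` {..<l} = orbit p v" using g(3) by (simp add: bij_betw_def)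
  have h': "h i \<in> A - {x}" "h i \<noteq> v" if "i < k - 1" for i
    using himg that OA v(2) by blast+
  have g': "g i \<in> A - {x}" "g i \<noteq> x" if "i < l" for i
    using gimg that OA disj self_orbit[of x] by blast+
  have gv: "g i \<noteq> v" if "Suc i < l" for i
    using g(3,6) that unfolding bij_betw_def inj_on_def
    by (metis Suc_lessD Suc_lessE diff_Suc_1 lessI lessThan_iff less_irrefl)
  have "cyclic_on ?q ((orbit p x - {x}) \<union> orbit p v)"
  proof (rule cyclic_on_concat[OF himg gimg])
    fix i assume i: "Suc i < k - 1"
    then show "?q (h i) = h (Suc i)"
      using q[OF h'(1), of i] h'(2)[of i] h'(1)[of "Suc i"] h(4)[of i] by simp
  next
    fix i assume i: "Suc i < l"
    then show "?q (g i) = g (Suc i)"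
      using q[OF g'(1), of i] gv[of i] g'(2)[of "Suc i"] g(4)[of i] by simp
  next
    assume k: "0 < k - 1"
    then have "Suc (k - 1 - 1) = k - 1" by simp
    then have "p (h (k - 1 - 1)) = x" using h(4)[of "k - 1 - 1"] h(1,6) by simp
    then show "?q (h (k - 1 - 1)) = (if l = 0 then h 0 else g 0)"
      using q[OF h'(1), of "k - 1 - 1"] h'(2)[of "k - 1 - 1"] k g(1,7) by simp
  next
    \<comment> \<open>If \<open>x\<close> is a fixed point of \<open>p\<close>, its list is empty
      and \<open>v\<close> returns to \<open>p v = g 0\<close> instead of passing to
      \<open>p x\<close>.\<close>
    have "p x = x \<longleftrightarrow> k = 1"
      using h(1,6,7) h'(1)[of 0] by (cases "k = 1") auto
    then show "?q (g (l - 1)) = (if k - 1 = 0 then g 0 else h 0)"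
      using q[of v] v(1) vx(1) h(1,7) g(6,7) by auto
  qed (use h g in auto)
  note cyc = this
  have crd: "card ((orbit p x - {x}) \<union> orbit p v) = k + l - 1"
    using disj h(1,2) g(2) finite_orbit_p self_orbit[of x] by (subst card_Un_disjoint) auto
  have spl1: "cycle_type p A = add_mset k (cycle_type p (A - orbit p x))" and i1: "p ` (A - orbit p x) \<subseteq> A - orbit p x"
    using cycle_type_split_orbit[OF x subset_refl p_image] h(2) by auto
  have spl2: "cycle_type p (A - orbit p x) = add_mset l (cycle_type p ?R)" and i2: "p ` ?R \<subseteq> ?R"
    using cycle_type_split_orbit[OF _ _ i1, of v] v g(2) by auto
  have qR: "?q z = p z" if "z \<in> ?R" for z
  proof -
    have "p z \<in> ?R" using i2 that by blast
    then have "p z \<noteq> x" "z \<noteq> v" "z \<noteq> x" using that self_orbit by auto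
    then show ?thesis using q[of z] that by auto
  qed
  have ctR: "cycle_type ?q ?R = cycle_type p ?R"
    using cycle_type_cong[OF i2, of ?q] qR by simp
  have "cycle_type ?q (((orbit p x - {x}) \<union> orbit p v) \<union> ?R) = {#k + l - 1#} + cycle_type p ?R"
    unfolding ctR[symmetric] crd[symmetric] cycle_type_cyclic[OF cyc, symmetric]
    using cyclic_on_inI[OF cyc] finite_orbit_p finA i2 qR by (intro cycle_type_Un) auto
  moreover have "((orbit p x - {x}) \<union> orbit p v) \<union> ?R = A - {x}"
    using OA self_orbit[of x] v disj by auto
  ultimately show ?thesis
    unfolding part_down2_def spl1 spl2 h(2) g(2) by simp
qed

text \<open>Within one cycle the transposition cuts. List the cycle as
  \<open>h 0 = p x, ..., h (k - 1) = x\<close> and let \<open>v = h (j - 1)\<close>: the first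
  \<open>j\<close> entries close up because \<open>v\<close> goes to \<open>p x\<close>, and the
  other \<open>k - 1 - j\<close> entries before \<open>x\<close> form the second cycle. The entry
  \<open>h (k - 2) = N (M x)\<close> is left out since it belongs to \<open>y = M x\<close>; hence
  \<open>j\<close> stops at \<open>k - 2\<close>.\<close>

lemma cycle_type_split:
  assumes x: "x \<in> A"
  obtains w where "bij_betw w {1..card (orbit p x) - 2} (orbit p x - {x, N (M x)})"
    "\<And>j. j \<in> {1..card (orbit p x) - 2} \<Longrightarrow> cycle_type (cp x (N (w j))) (A - {x}) =
      part_up (card (orbit p x) - 1 - j) j (cycle_type p A)"
proof -
  let ?R = "A - orbit p x"
  obtain h k where h: "0 < k" "card (orbit p x) = k" "bij_betw h {..<k} (orbit p x)"
    "\<And>i. Suc i < k \<Longrightarrow> p (h i) = h (Suc i)" "p (h (k - 1)) = h 0" "h (k - 1) = x" "h (0::nat) = p x"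
    using chain_permutes[OF perm fin, of x] by metis
  have OA: "orbit p x \<subseteq> A" using x orbit_sub by auto
  have himg: "h ` {..<k - 1} = orbit p x - {x}" using orbit_minus_last h by blast
  have inj: "inj_on h {..<k}" using h(3) by (simp add: bij_betw_def)
  have ppx: "p (N (M x)) = x" by (simp add: comp_apply)
  have spl1: "cycle_type p A = add_mset k (cycle_type p ?R)" and i1: "p ` ?R \<subseteq> ?R"
    using cycle_type_split_orbit[OF x subset_refl p_image] h(2) by auto
  have NMx: "N (M x) = h (k - 2)" if "2 \<le> k"
  proof -
    have "p (h (k - 2)) = h (Suc (k - 2))" using h(4)[of "k - 2"] that by simp
    also have "Suc (k - 2) = k - 1" using that by simp
    finally have "p (h (k - 2)) = p (N (M x))" using h(6) ppx by simp
    then show ?thesis using permutes_inj[OF perm] by (simp add: inj_eq)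
  qed
  \<comment> \<open>For \<open>k = 1\<close> the orbit is \<open>{x}\<close>, and truncated
    subtraction makes the index set empty as well.\<close>
  have img: "h ` {..<k - 2} = orbit p x - {x, N (M x)}"
  proof (cases "2 \<le> k")
    case True
    then have e: "{..<k - 2} = {..<k - 1} - {k - 2}" by auto
    have "h ` ({..<k - 1} - {k - 2}) = h ` {..<k - 1} - h ` {k - 2}"
      by (rule inj_on_image_set_diff[OF inj]) (use True in auto)
    then have "h ` {..<k - 2} = orbit p x - {x} - {N (M x)}"
      unfolding e himg NMx[OF True] by simp
    then show ?thesis by blast
  next
    case False
    then have k: "k = 1" using h(1) by simp
    then have "orbit p x = {x}" using himg self_orbit[of x] by auto
    then show ?thesis using k by auto
  qed
  have shift: "bij_betw (\<lambda>j. j - 1) {1..k - 2} {..<k - 2}"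
    by (rule bij_betw_byWitness[where f' = Suc]) auto
  have "inj_on h {..<k - 2}" by (rule inj_on_subset[OF inj]) auto
  then have "bij_betw h {..<k - 2} (orbit p x - {x, N (M x)})" using img by (simp add: bij_betw_def)
  then have bij: "bij_betw (h \<circ> (\<lambda>j. j - 1)) {1..k - 2} (orbit p x - {x, N (M x)})"
    using shift by (rule bij_betw_trans[rotated])
  have "cycle_type (cp x (N (h (j - 1)))) (A - {x}) = part_up (k - 1 - j) j (cycle_type p A)"
    if j: "j \<in> {1..k - 2}" for j
  proof -
    define v where "v = h (j - 1)"
    let ?q = "cp x (N v)"
    have jj: "1 \<le> j" "j + 2 \<le> k" using j by auto
    have "v \<in> orbit p x - {x, N (M x)}"
      unfolding v_def img[symmetric] using jj by (intro imageI) auto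
    then have v: "v \<in> A" "v \<noteq> x" "p v \<noteq> x" "v \<in> orbit p x"
      using OA ppx permutes_inj[OF perm] by (auto simp: inj_def comp_apply)
    note q = contract_opposite(2)[OF x v(1-3)]
    have h': "h i \<in> A - {x}" if "i < k - 1" for i
      using himg that OA by blast
    have hv: "h i = v \<longleftrightarrow> i = j - 1" if "i < k" for i
      using inj that jj unfolding v_def inj_on_def by auto
    have px: "p x \<noteq> x" using h'[of 0] h(7) jj by auto
    have pv: "p v = h j" using h(4)[of "j - 1"] jj by (simp add: v_def)
    have c1: "cyclic_on ?q (h ` {..<j})"
    proof (rule cyclic_onI_chain)
      fix i assume "Suc i < j"
      then show "?q (h i) = h (Suc i)"
        using q[OF h', of i] hv[of i] h'[of "Suc i"] h(4)[of i] jj by auto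
    next
      show "?q (h (j - 1)) = h 0" using q[of v] v px h(7) by (simp add: v_def)
    qed (use jj in simp)
    have c2: "cyclic_on ?q ((\<lambda>i. h (i + j)) ` {..<k - 1 - j})"
    proof (rule cyclic_onI_chain)
      fix i assume i: "Suc i < k - 1 - j"
      then show "?q (h (i + j)) = h (Suc i + j)"
        using q[OF h', of "i + j"] hv[of "i + j"] h'[of "Suc (i + j)"] h(4)[of "i + j"] jj by auto
    next
      have e: "k - 1 - j - 1 + j = k - 2" using jj by simp
      have "p (h (k - 2)) = x" using NMx ppx jj by simp
      then show "?q (h (k - 1 - j - 1 + j)) = h (0 + j)"
        unfolding e using q[OF h', of "k - 2"] hv[of "k - 2"] jj pv by auto
    qed (use jj in simp)
    have im2: "(\<lambda>i. h (i + j)) ` {..<k - 1 - j} = h ` {j..<k - 1}"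
    proof -
      have "(\<lambda>i. i + j) ` {..<k - 1 - j} = {j..<k - 1}"
        using jj by (simp add: lessThan_atLeast0)
      then show ?thesis by (metis image_image)
    qed
    note c2' = c2[unfolded im2]
    have cr: "card (h ` {..<j}) = j" "card (h ` {j..<k - 1}) = k - 1 - j"
    proof -
      have "{..<j} \<subseteq> {..<k}" "{j..<k - 1} \<subseteq> {..<k}" using jj by auto
      then show "card (h ` {..<j}) = j" "card (h ` {j..<k - 1}) = k - 1 - j"
        using inj_on_subset[OF inj] by (simp_all add: card_image)
    qed
    have un: "h ` {..<j} \<union> h ` {j..<k - 1} = orbit p x - {x}"
    proof -
      have "{..<j} \<union> {j..<k - 1} = {..<k - 1}" using jj by auto
      then show ?thesis using himg by (metis image_Un)
    qed
    have dj: "h ` {..<j} \<inter> h ` {j..<k - 1} = {}"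
      using jj by (subst inj_on_image_Int[OF inj, symmetric]) auto
    have "cycle_type ?q (h ` {..<j} \<union> h ` {j..<k - 1}) = {#j#} + {#k - 1 - j#}"
      using cycle_type_Un[OF _ _ dj] cycle_type_cyclic[OF c1] cycle_type_cyclic[OF c2'] cr
        cyclic_on_inI[OF c1] cyclic_on_inI[OF c2'] by (simp add: image_subset_iff)
    then have ct: "cycle_type ?q (orbit p x - {x}) = {#j#} + {#k - 1 - j#}" by (simp only: un)
    have iO: "?q ` (orbit p x - {x}) \<subseteq> orbit p x - {x}"
      unfolding un[symmetric] using cyclic_on_inI[OF c1] cyclic_on_inI[OF c2'] by blast
    have qR: "?q z = p z" if "z \<in> ?R" for z
    proof -
      have "p z \<in> ?R" using i1 that by blast
      then have "p z \<noteq> x" "z \<noteq> v" "z \<noteq> x" using that self_orbit v(4) by auto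
      then show ?thesis using q[of z] that by auto
    qed
    have ctR: "cycle_type ?q ?R = cycle_type p ?R"
      using cycle_type_cong[OF i1, of ?q] qR by simp
    have "cycle_type ?q ((orbit p x - {x}) \<union> ?R) = {#j#} + {#k - 1 - j#} + cycle_type p ?R"
      unfolding ctR[symmetric] ct[symmetric]
      using iO finite_orbit_p finA i1 qR by (intro cycle_type_Un) auto
    moreover have "(orbit p x - {x}) \<union> ?R = A - {x}" using OA self_orbit[of x] by auto
    moreover have "k - 1 - j + j + 1 = k" using jj by simp
    ultimately show ?thesis unfolding part_up_def spl1 v_def[symmetric] by simp
  qed
  then show thesis using that[OF bij[folded h(2)]] h(2) by (simp add: comp_apply)
qed

end

end

section \<open>Contracting an edge within a colour\<close>

context coloured_matchings
begin

context
  notes comp_apply [simp del]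
begin

text \<open>Deleting \<open>x\<close> and \<open>y\<close> leaves two arcs. For equal colours each
  arc has lost an edge of \<open>M\<close> at one end and an edge of \<open>N\<close> at the other,
  so joining ends of the same kind produces a single cycle again, with one arc reversed. For
  opposite colours both ends of an arc have lost edges of the same matching, and each arc closes up
  on itself.\<close>

lemma contract_same_orbit:
  assumes x: "x \<in> A" and y: "y \<in> orbit p x" "y \<noteq> x"
  obtains A' where "coloured_matchings (S - {x, y}) A' (contract x y M) (contract x y N)"
    "cycle_type (cp x y) A' = part_down1 (card (orbit p x)) (cycle_type p A)"
proof -
  let ?R = "A - orbit p x" and ?M = "contract x y M" and ?N = "contract x y N"
  obtain h k where h: "0 < k" "card (orbit p x) = k" "bij_betw h {..<k} (orbit p x)"
    "\<And>i. Suc i < k \<Longrightarrow> p (h i) = h (Suc i)" "p (h (k - 1)) = h 0" "h (0::nat) = x"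
    using orbit_chain[OF perm fin, of x] by metis
  \<comment> \<open>The cycle reads \<open>h 0, b 0, h 1, b 1, ...\<close>: edges of
    \<open>N\<close> join \<open>h i\<close> to \<open>b i\<close>, edges of \<open>M\<close> join
    \<open>b i\<close> to \<open>h (Suc i)\<close>, and the last \<open>b\<close> is joined to
    \<open>h 0 = x\<close>.\<close>
  define b where "b i = N (h i)" for i
  have OA: "orbit p x \<subseteq> A" using x orbit_sub by auto
  have himg: "h ` {..<k} = orbit p x" using h(3) by (simp add: bij_betw_def)
  have hO: "h i \<in> orbit p x" if "i < k" for i using himg that by blast
  have hA: "h i \<in> A" if "i < k" for i using hO[OF that] OA by blast
  have hS: "h i \<in> S" if "i < k" for i using hA[OF that] sub by blast
  have hinj: "h i = h j \<longleftrightarrow> i = j" if "i < k" "j < k" for i j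
    using h(3) that by (auto simp: bij_betw_def inj_on_def)
  have binj: "b i = b j \<longleftrightarrow> i = j" if "i < k" "j < k" for i j
    using hinj[OF that] by (simp add: b_def)
  have bA: "b i \<notin> A" if "i < k" for i using Ncol[of "h i"] hA[OF that] sub by (auto simp: b_def)
  have bh: "b i \<noteq> h j" if "i < k" "j < k" for i j using bA[OF that(1)] hA[OF that(2)] by auto
  obtain q where q: "q < k" "y = h q" using y(1) himg by blast
  then have q0: "0 < q" using y(2) h(6) by (cases q) auto
  have yA: "y \<in> A" using q hA by auto
  have ne: "y \<noteq> x" "M x \<noteq> y" "N x \<noteq> y"
    using y(2) yA Mcol[of x] Ncol[of x] x sub by auto
  have xy: "x \<in> S" "y \<in> S" using x yA sub by auto
  have hxy: "h i = x \<longleftrightarrow> i = 0" "h i = y \<longleftrightarrow> i = q" if "i < k" for i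
    using hinj[OF that, of 0] hinj[OF that q(1)] h(1,6) q by auto
  have bxy: "b i \<noteq> x" "b i \<noteq> y" if "i < k" for i using bA[OF that] x yA by auto
  have Mb: "M (b i) = (if Suc i < k then h (Suc i) else x)" if "i < k" for i
  proof (cases "Suc i < k")
    case True
    then show ?thesis using h(4)[of i] by (simp add: b_def comp_apply)
  next
    case False
    then have "i = k - 1" using that by simp
    then show ?thesis using h(5,6) False by (simp add: b_def comp_apply)
  qed
  have Mh: "M (h i) = b (i - 1)" if "0 < i" "i < k" for i
    using Mb[of "i - 1"] that MM[of "b (i - 1)"] by simp
  have Mx: "M x = b (k - 1)" using Mb[of "k - 1"] h(1) MM[of "b (k - 1)"] by simp
  have My: "M y = b (q - 1)" using Mh[OF q0 q(1)] q by simp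
  have Nb: "N (b i) = h i" and Nh: "N (h i) = b i" for i by (simp_all add: b_def)
  have Nx: "N x = b 0" and Ny: "N y = b q" using h(6) q by (simp_all add: b_def)
  have N'h: "?N (h m) = b m" if "m < k" "m \<noteq> 0" "m \<noteq> q" for m
    using that hxy[OF that(1)] bxy[OF that(1)] by (simp add: contract_def Nh)
  have N'b: "?N (b m) = (if m = 0 then b q else if m = q then b 0 else h m)" if "m < k" for m
    using hxy[OF that] bxy[OF that] q0 by (simp add: contract_def Nb Nx Ny)
  have M'h: "?M (h m) = b (m - 1)" if "0 < m" "m < k" "m \<noteq> q" for m
    using that hxy[OF that(2)] bxy[of "m - 1"] by (simp add: contract_def Mh)
  have M'b: "?M (b m) = (if m = k - 1 then b (q - 1) else if m = q - 1 then b (k - 1) else h (Suc m))"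
    if "m < k" for m
  proof (cases "Suc m < k")
    case True
    then show ?thesis
      using bxy[OF that] hxy[OF True] q0 by (auto simp: contract_def Mb[OF that] Mx)
  next
    case False
    then have "m = k - 1" "M (b m) = x" using that Mb[OF that] by simp_all
    then show ?thesis using bxy[OF that] by (simp add: contract_def My)
  qed
  have R: "?M z = M z" "cp x y z = p z" "p z \<in> ?R" if "z \<in> ?R" for z
  proof -
    have z: "z \<in> A" "z \<in> S" "z \<noteq> x" "z \<noteq> y" using that sub y(1) self_orbit by auto
    then have "M z \<notin> A" "N z \<notin> A" using Mcol Ncol by auto
    then show "?M z = M z" using z x yA by (auto simp: contract_def)
    show pz: "p z \<in> ?R" using that pA p_orbit_iff by blast
    then have "p z \<noteq> x" "p z \<noteq> y" using y(1) self_orbit by auto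
    then show "cp x y z = p z"
      using z \<open>N z \<notin> A\<close> x yA by (auto simp: cp_def contract_def comp_apply)
  qed
  \<comment> \<open>The old colouring is no longer proper: on one of the two arcs between \<^term>\<open>x\<close> and \<^term>\<open>y\<close> the colours
    have to be exchanged. The new colour class meets the cycle in \<^term>\<open>X \<union> Y\<close>.\<close>
  define X where "X = h ` {q<..<k}"
  define Y where "Y = b ` {..<q}"
  have "(\<lambda>i. i + Suc q) ` {..<k - 1 - q} = {q<..<k}"
  proof (intro set_eqI iffI)
    fix i assume "i \<in> {q<..<k}"
    then show "i \<in> (\<lambda>i. i + Suc q) ` {..<k - 1 - q}" by (intro image_eqI[of _ _ "i - Suc q"]) auto
  qed auto
  then have Ximg: "(\<lambda>i. h (i + Suc q)) ` {..<k - 1 - q} = X"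
    unfolding X_def by (metis image_image)
  \<comment> \<open>The indices decrease, because \<open>cp x y\<close> runs through this arc
    against the direction of \<open>p\<close>.\<close>
  have Yimg: "(\<lambda>i. b (q - 1 - i)) ` {..<q} = Y"
  proof -
    have "(\<lambda>i. q - 1 - i) ` {..<q} = {..<q}"
    proof (intro set_eqI iffI)
      fix i assume "i \<in> {..<q}"
      then show "i \<in> (\<lambda>i. q - 1 - i) ` {..<q}" by (intro image_eqI[of _ _ "q - 1 - i"]) auto
    qed auto
    then show ?thesis unfolding Y_def by (metis image_image)
  qed
  have cyc: "cyclic_on (cp x y) (X \<union> Y)"
  proof (rule cyclic_on_concat[OF Ximg Yimg])
    fix i assume i: "Suc i < k - 1 - q"
    then show "cp x y (h (i + Suc q)) = h (Suc i + Suc q)"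
      by (auto simp: cp_def comp_apply N'h M'b)
  next
    fix i assume i: "Suc i < q"
    then have "cp x y (b (q - 1 - i)) = b (q - 1 - i - 1)"
      using q(1) by (auto simp: cp_def comp_apply N'b M'h)
    then show "cp x y (b (q - 1 - i)) = b (q - 1 - Suc i)" by simp
  next
    assume "0 < k - 1 - q"
    moreover from this have "k - 1 - q - 1 + Suc q = k - 1" by simp
    ultimately show "cp x y (h (k - 1 - q - 1 + Suc q)) = (if q = 0 then h (0 + Suc q) else b (q - 1 - 0))"
      using q0 h(1) by (simp only:) (auto simp: cp_def comp_apply N'h M'b)
  next
    show "cp x y (b (q - 1 - (q - 1))) = (if k - 1 - q = 0 then b (q - 1 - 0) else h (0 + Suc q))"
      using q0 q(1) h(1) by (auto simp: cp_def comp_apply N'b M'b)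
  qed (use q0 in simp)
  have fXY: "finite X" "finite Y" by (simp_all add: X_def Y_def)
  have XA: "X \<subseteq> orbit p x" using hO by (auto simp: X_def)
  have YA: "Y \<inter> A = {}" using bA q(1) by (auto simp: Y_def)
  have bY: "b m \<in> Y \<longleftrightarrow> m < q" if "m < k" for m
    unfolding Y_def image_iff using binj[OF that] q(1) by (metis lessThan_iff order.strict_trans)
  have hX: "h m \<in> X \<longleftrightarrow> q < m" if "m < k" for m
    unfolding X_def image_iff using hinj[OF that] that by (metis greaterThanLessThan_iff)
  have "inj_on h {q<..<k}" "inj_on b {..<q}" using hinj binj q(1) by (auto simp: inj_on_def)
  then have cX: "card X = k - 1 - q" and cY: "card Y = q" by (simp_all add: X_def Y_def card_image)
  have cXY: "card (X \<union> Y) = k - 1"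
    using fXY cX cY XA YA OA q(1) by (subst card_Un_disjoint) auto
  define A' where "A' = (X \<union> Y) \<union> ?R"
  have dj: "(X \<union> Y) \<inter> ?R = {}" using XA YA by auto
  have k2: "1 < k" using q0 q(1) by simp
  have invR: "p ` ?R \<subseteq> ?R" using R(3) by blast
  have "cycle_type (cp x y) ?R = cycle_type p ?R"
    using cycle_type_cong[OF invR, of "cp x y"] R(2) by simp
  then have "cycle_type (cp x y) A' = {#k - 1#} + cycle_type p ?R"
    unfolding A'_def using cycle_type_Un[OF _ _ dj, of "cp x y"] cycle_type_cyclic[OF cyc] cXY
      cyclic_on_inI[OF cyc] R fXY finA by (simp add: image_subset_iff)
  moreover have "cycle_type p A = add_mset k (cycle_type p ?R)"
    using cycle_type_split_orbit[OF x subset_refl p_image] h(2) by auto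
  ultimately have ct: "cycle_type (cp x y) A' = part_down1 (card (orbit p x)) (cycle_type p A)"
    using k2 by (simp add: part_down1_def h(2))
  have "coloured_matchings (S - {x, y}) A' ?M ?N"
  proof (rule coloured_matchingsI)
    have bS: "b i \<in> S - {x, y}" if "i < k" for i using hS[OF that] bxy[OF that] by (simp add: b_def)
    have "Y \<subseteq> S - {x, y}" unfolding Y_def by (rule image_subsetI, rule bS) (use q(1) in simp)
    moreover have "x \<notin> X" "y \<notin> X" using hX[OF h(1)] hX[OF q(1)] h(6) q(2) by auto
    then have "X \<subseteq> S - {x, y}" using XA OA sub by blast
    moreover have "?R \<subseteq> S - {x, y}" using sub self_orbit[of x] y(1) by blast
    ultimately show "A' \<subseteq> S - {x, y}" by (simp add: A'_def)
    show "matching (S - {x, y}) ?M" "matching (S - {x, y}) ?N"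
      using matching_contract[OF M xy] matching_contract[OF N xy] ne by auto
    show "(?M \<circ> ?N) ` A' \<subseteq> A'"
      using cyclic_on_inI[OF cyc] R unfolding A'_def cp_def[symmetric] by auto
    have "card A' = k - 1 + (card A - k)"
      unfolding A'_def using cXY fXY finA dj OA h(2)
      by (subst card_Un_disjoint) (auto simp: card_Diff_subset finite_orbit_p)
    moreover have "k \<le> card A" using card_mono[OF finA OA] h(2) by simp
    moreover have "card (S - {x, y}) = card S - 2" using xy ne(1) by (simp add: card_Diff_subset)
    ultimately show "card (S - {x, y}) = 2 * card A'" using card_S k2 by simp
    fix z assume "z \<in> A'"
    then consider m where "z = h m" "q < m" "m < k" | m where "z = b m" "m < q" | "z \<in> ?R"
      by (auto simp: A'_def X_def Y_def)
    then show "?M z \<notin> A'"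
    proof cases
      case 1
      then have e: "?M z = b (m - 1)" "m - 1 < k" using M'h by auto
      then have "?M z \<notin> A" using bA by simp
      moreover have "?M z \<notin> Y" using e 1 bY by auto
      ultimately show ?thesis using XA OA by (auto simp: A'_def)
    next
      case 2
      show ?thesis
      proof (cases "m = q - 1")
        case True
        then have e: "?M z = b (k - 1)" using M'b[of m] 2 q(1) by auto
        then have "?M z \<notin> A" using bA h(1) by simp
        moreover have "?M z \<notin> Y" using e bY[of "k - 1"] h(1) q(1) by auto
        ultimately show ?thesis using XA OA by (auto simp: A'_def)
      next
        case False
        then have e: "?M z = h (Suc m)" "Suc m < q" using M'b[of m] 2 q(1) by auto
        then have "?M z \<in> orbit p x" using hO q(1) by simp
        moreover have "?M z \<notin> X" using e hX[of "Suc m"] q(1) by auto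
        ultimately show ?thesis using YA OA by (auto simp: A'_def)
      qed
    next
      case 3
      then have "M z \<notin> A" using Mcol[of z] sub by auto
      moreover have "M z \<noteq> b m" if "m < q" for m
      proof
        assume "M z = b m"
        then have "z = M (b m)" by (metis MM)
        then have "z \<in> orbit p x" using Mb[of m] that q(1) hO by auto
        then show False using 3 by simp
      qed
      ultimately show ?thesis using R(1)[OF 3] XA OA by (auto simp: A'_def Y_def)
    qed
  qed (use fin in simp)
  then show thesis using that ct by blast
qed

text \<open>Exchanging the colours on the cycle of \<^term>\<open>y\<close> reduces this to vertices of opposite colours.\<close>

lemma contract_same_colour_join:
  assumes x: "x \<in> A" and y: "y \<in> A" "y \<notin> orbit p x"
  obtains A' where "coloured_matchings (S - {x, y}) A' (contract x y M) (contract x y N)"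
    "cycle_type (cp x y) A' = part_down2 (card (orbit p x)) (card (orbit p y)) (cycle_type p A)"
proof -
  let ?T = "orbit p y"
  let ?B = "(A - ?T) \<union> M ` ?T"
  have T: "?T \<subseteq> A" "p ` ?T \<subseteq> ?T" using orbit_sub[OF y(1)] p_orbit_iff by blast+
  interpret f: coloured_matchings S ?B M N by (rule flip(1)[OF T])
  have "x \<notin> ?T" using orbits_disjoint[OF y(2)] self_orbit by blast
  then have xB: "x \<in> ?B" using x by simp
  \<comment> \<open>The lemmas on opposite colours address the second vertex as \<open>N v\<close>.
    Here \<open>v = N y\<close>, so it is \<open>N y\<close> that must lie in the exchanged
    class.\<close>
  have "N y = M (p y)" by (simp add: comp_apply)
  moreover have "p y \<in> ?T" using p_orbit_iff self_orbit by blast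
  ultimately have NyB: "N y \<in> ?B" by auto
  have "N y \<notin> A" using Ncol[of y] y(1) sub by auto
  then have No: "N y \<notin> orbit p x" using orbit_sub[OF x] by blast
  have v: "N y \<noteq> x" "p (N y) \<noteq> x"
    using No p_orbit_iff[of "N y" x] self_orbit[of x] by auto
  show thesis
  proof (rule that)
    show "coloured_matchings (S - {x, y}) (?B - {x}) (contract x y M) (contract x y N)"
      using f.contract_opposite(1)[OF xB NyB v] by simp
    show "cycle_type (cp x y) (?B - {x}) =
        part_down2 (card (orbit p x)) (card (orbit p y)) (cycle_type p A)"
      using f.cycle_type_join[OF xB NyB No] by (simp add: orbit_N flip(2)[OF T])
  qed
qed

end

end

section \<open>The recursion for joint matchings\<close>

abbreviation opposite :: "nat set \<Rightarrow> nat \<Rightarrow> nat \<Rightarrow> bool" where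
  "opposite A z w \<equiv> (z \<in> A \<longleftrightarrow> w \<notin> A)"

abbreviation unrestricted :: "nat \<Rightarrow> nat \<Rightarrow> bool" where
  "unrestricted z w \<equiv> True"

text \<open>The sums are formed for an arbitrary function \<open>F\<close> of the type, since the
  induction supplies \<open>F\<close> before it is identified with a coefficient.\<close>

definition cut_join :: "(nat multiset \<Rightarrow> nat) \<Rightarrow> nat \<Rightarrow> nat multiset \<Rightarrow> nat" where
  "cut_join F k lam = (\<Sum>d = 1..k - 2. F (part_up (k - 1 - d) d lam))
     + (\<Sum>l\<in>#lam - {#k#}. l * F (part_down2 k l lam))"

definition cut_join_unoriented :: "(nat multiset \<Rightarrow> nat) \<Rightarrow> nat \<Rightarrow> nat multiset \<Rightarrow> nat" where
  "cut_join_unoriented F k lam = (k - 1) * F (part_down1 k lam)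
     + (\<Sum>d = 1..k - 2. F (part_up (k - 1 - d) d lam))
     + 2 * (\<Sum>l\<in>#lam - {#k#}. l * F (part_down2 k l lam))"

text \<open>Lets \<open>A\<close> be replaced by \<open>A - {x}\<close> in the colour restriction:
  no vertex that survives the contraction changes colour.\<close>

lemma joint_cong:
  assumes "\<And>z w. z \<in> S \<Longrightarrow> w \<in> S \<Longrightarrow> R z w \<longleftrightarrow> R' z w"
  shows "joint R S M N = joint R' S M N"
proof -
  have "(\<forall>z\<in>S. R z (L z)) \<longleftrightarrow> (\<forall>z\<in>S. R' z (L z))" if "matching S L" for L
    using assms matching_mem[OF that] by simp
  then show ?thesis unfolding joint_def by auto
qed

context coloured_matchings
begin

context
  notes comp_apply [simp del]
begin

lemma cycle_type_minus_orbit: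
  "x \<in> A \<Longrightarrow> cycle_type p (A - orbit p x) = cycle_type p A - {#card (orbit p x)#}"
  using cycle_type_split_orbit(1)[OF _ subset_refl p_image] by simp

lemma NMx_orbit: "N (M x) \<in> orbit p x"
  using p_orbit_iff[of "N (M x)" x] self_orbit by (simp add: comp_apply)

lemma sum_outside_orbit:
  assumes "x \<in> A"
  shows "(\<Sum>v\<in>A - orbit p x. F (part_down2 (card (orbit p x)) (card (orbit p v)) (cycle_type p A)) :: nat) =
    (\<Sum>l\<in>#cycle_type p A - {#card (orbit p x)#}. l * F (part_down2 (card (orbit p x)) l (cycle_type p A)))"
proof -
  have "A - orbit p x \<subseteq> S" using sub by blast
  from sum_mset_cycle_type[OF perm fin this cycle_type_split_orbit(2)[OF assms subset_refl p_image],
      of "\<lambda>l. F (part_down2 (card (orbit p x)) l (cycle_type p A))"]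
  show ?thesis unfolding cycle_type_minus_orbit[OF assms] .
qed

lemma sum_opposite:
  assumes x: "x \<in> A"
  shows "(\<Sum>v\<in>A - {x, N (M x)}. F (cycle_type (cp x (N v)) (A - {x}))) =
    cut_join F (card (orbit p x)) (cycle_type p A)"
proof -
  let ?k = "card (orbit p x)" and ?O = "orbit p x" and ?g = "\<lambda>v. F (cycle_type (cp x (N v)) (A - {x}))"
  obtain w where w: "bij_betw w {1..?k - 2} (?O - {x, N (M x)})"
    "\<And>j. j \<in> {1..?k - 2} \<Longrightarrow> cycle_type (cp x (N (w j))) (A - {x}) = part_up (?k - 1 - j) j (cycle_type p A)"
    using cycle_type_split[OF x] by metis
  have "A - {x, N (M x)} = (?O - {x, N (M x)}) \<union> (A - ?O)"
    using orbit_sub[OF x] NMx_orbit[of x] self_orbit[of x] by blast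
  then have "sum ?g (A - {x, N (M x)}) = sum ?g (?O - {x, N (M x)}) + sum ?g (A - ?O)"
    using finite_orbit_p finA by (auto intro!: sum.union_disjoint)
  also have "sum ?g (?O - {x, N (M x)}) = (\<Sum>d = 1..?k - 2. F (part_up (?k - 1 - d) d (cycle_type p A)))"
    using sum.reindex_bij_betw[OF w(1), of ?g] w(2) by simp
  also have "sum ?g (A - ?O) = (\<Sum>v\<in>A - ?O. F (part_down2 ?k (card (orbit p v)) (cycle_type p A)))"
    using cycle_type_join[OF x] by (intro sum.cong) auto
  finally show ?thesis unfolding cut_join_def sum_outside_orbit[OF x] .
qed

text \<open>The part common to both recursions. \<open>R'\<close> takes the colour class as an
  argument because the bipartite restriction must follow the class from \<open>A\<close> to
  \<open>A - {x}\<close>; for unrestricted matchings it is constant.\<close>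

lemma card_joint_opposite_colours:
  assumes x: "x \<in> A" and n: "card A = Suc n"
    and R: "\<And>v. v \<in> A \<Longrightarrow> joint R (S - {x, N v}) (contract x (N v) M) (contract x (N v) N) =
      joint (R' (A - {x})) (S - {x, N v}) (contract x (N v) M) (contract x (N v) N)"
    and F: "\<And>S' A' M' N'. coloured_matchings S' A' M' N' \<Longrightarrow> card A' = n \<Longrightarrow>
      card (joint (R' A') S' M' N') = F (cycle_type (M' \<circ> N') A')"
  shows "(\<Sum>y\<in>S - A - {M x, N x}. card (joint R (S - {x, y}) (contract x y M) (contract x y N))) =
    cut_join F (card (orbit p x)) (cycle_type p A)"
proof -
  \<comment> \<open>The partner \<open>y\<close> is indexed by \<open>v = N y\<close> in
    \<open>A\<close>; the forbidden partners \<open>N x\<close> and \<open>M x\<close> become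
    \<open>v = x\<close> and \<open>v = N (M x)\<close>.\<close>
  have img: "N ` (A - {x, N (M x)}) = S - A - {M x, N x}"
  proof (intro set_eqI iffI)
    fix y assume "y \<in> N ` (A - {x, N (M x)})"
    then obtain v where v: "v \<in> A" "v \<noteq> x" "v \<noteq> N (M x)" "y = N v" by auto
    then have "y \<noteq> M x" by (metis NN)
    then show "y \<in> S - A - {M x, N x}" using v sub Ncol[of v] by auto
  next
    fix y assume y: "y \<in> S - A - {M x, N x}"
    then have "N y \<in> A" using Ncol[of y] by auto
    moreover have "N y \<noteq> x" "N y \<noteq> N (M x)" using y NN[of y] by auto
    ultimately show "y \<in> N ` (A - {x, N (M x)})" by (intro image_eqI[of _ _ "N y"]) auto
  qed
  have "inj_on N (A - {x, N (M x)})" by (simp add: inj_on_def)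
  then have "(\<Sum>y\<in>S - A - {M x, N x}. card (joint R (S - {x, y}) (contract x y M) (contract x y N))) =
      (\<Sum>v\<in>A - {x, N (M x)}. card (joint R (S - {x, N v}) (contract x (N v) M) (contract x (N v) N)))"
    unfolding img[symmetric] by (simp add: sum.reindex comp_apply)
  also have "\<dots> = (\<Sum>v\<in>A - {x, N (M x)}. F (cycle_type (cp x (N v)) (A - {x})))"
  proof (rule sum.cong[OF refl])
    fix v assume v: "v \<in> A - {x, N (M x)}"
    then have "p v \<noteq> x" by (metis DiffE MM NN comp_apply insertCI)
    then have q: "coloured_matchings (S - {x, N v}) (A - {x}) (contract x (N v) M) (contract x (N v) N)"
      using contract_opposite(1)[OF x, of v] v by auto
    show "card (joint R (S - {x, N v}) (contract x (N v) M) (contract x (N v) N)) =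
        F (cycle_type (cp x (N v)) (A - {x}))"
      using F[OF q] R[of v] v x n finA by (simp add: cp_def)
  qed
  also have "\<dots> = cut_join F (card (orbit p x)) (cycle_type p A)" by (rule sum_opposite[OF x])
  finally show ?thesis .
qed

lemma card_joint_opposite:
  assumes x: "x \<in> A" and n: "card A = Suc n" "1 \<le> n"
    and F: "\<And>S' A' M' N'. coloured_matchings S' A' M' N' \<Longrightarrow> card A' = n \<Longrightarrow>
      card (joint (opposite A') S' M' N') = F (cycle_type (M' \<circ> N') A')"
  shows "card (joint (opposite A) S M N) = cut_join F (card (orbit p x)) (cycle_type p A)"
proof -
  have "card (joint (opposite A) S M N) = (\<Sum>y\<in>{y \<in> S - {x, M x, N x}. opposite A x y}.
      card (joint (opposite A) (S - {x, y}) (contract x y M) (contract x y N)))"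
    using n card_S sub x by (intro card_joint_recursion[OF fin _ M N]) auto
  also have "{y \<in> S - {x, M x, N x}. opposite A x y} = S - A - {M x, N x}"
    using x by auto
  also have "(\<Sum>y\<in>S - A - {M x, N x}. card (joint (opposite A) (S - {x, y}) (contract x y M) (contract x y N))) =
      cut_join F (card (orbit p x)) (cycle_type p A)"
    by (rule card_joint_opposite_colours[where R' = opposite, OF x n(1) _ F], rule joint_cong) auto
  finally show ?thesis .
qed

lemma card_joint_unrestricted:
  assumes x: "x \<in> A" and n: "card A = Suc n" "1 \<le> n"
    and F: "\<And>S' A' M' N'. coloured_matchings S' A' M' N' \<Longrightarrow> card A' = n \<Longrightarrow>
      card (joint unrestricted S' M' N') = F (cycle_type (M' \<circ> N') A')"
  shows "card (joint unrestricted S M N) = cut_join_unoriented F (card (orbit p x)) (cycle_type p A)"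
proof -
  let ?g = "\<lambda>y. card (joint unrestricted (S - {x, y}) (contract x y M) (contract x y N))"
  let ?k = "card (orbit p x)" and ?O = "orbit p x"
  have O: "?O \<subseteq> A" "x \<in> ?O" using x orbit_sub self_orbit by auto
  have "M x \<notin> A" "N x \<notin> A" "x \<in> S" using x sub Mcol Ncol by auto
  \<comment> \<open>The forbidden partners \<open>M x\<close> and \<open>N x\<close> have the other
    colour, so they are missing only from the first of the three groups. The last group yields the
    second copy of the merging sum.\<close>
  then have Y: "{y \<in> S - {x, M x, N x}. True} = (S - A - {M x, N x}) \<union> ((?O - {x}) \<union> (A - ?O))"
    using x sub O by auto
  have "card (joint unrestricted S M N) = sum ?g {y \<in> S - {x, M x, N x}. True}"
    using n card_S sub x by (intro card_joint_recursion[OF fin _ M N]) auto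
  also have "\<dots> = sum ?g (S - A - {M x, N x}) + sum ?g ((?O - {x}) \<union> (A - ?O))"
    unfolding Y using fin finA finite_orbit_p O by (intro sum.union_disjoint) auto
  also have "sum ?g ((?O - {x}) \<union> (A - ?O)) = sum ?g (?O - {x}) + sum ?g (A - ?O)"
    using finA finite_orbit_p by (intro sum.union_disjoint) auto
  also have "sum ?g (S - A - {M x, N x}) = cut_join F ?k (cycle_type p A)"
    by (rule card_joint_opposite_colours[where R' = "\<lambda>_. unrestricted", OF x n(1) _ F]) auto
  also have "sum ?g (?O - {x}) = (\<Sum>y\<in>?O - {x}. F (part_down1 ?k (cycle_type p A)))"
  proof (rule sum.cong[OF refl])
    fix y assume y: "y \<in> ?O - {x}"
    then obtain A' where A': "coloured_matchings (S - {x, y}) A' (contract x y M) (contract x y N)"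
      "cycle_type (cp x y) A' = part_down1 ?k (cycle_type p A)"
      using contract_same_orbit[OF x, of y] by auto
    have "x \<noteq> y" "x \<in> S" "y \<in> S" using y x sub O by auto
    then have "card (S - {x, y}) = card S - 2" by (simp add: card_Diff_subset)
    \<comment> \<open>\<open>A'\<close> is known only to exist, but any colour class contains half
      of the vertices, which fixes its size.\<close>
    then have "card A' = n" using coloured_matchings.card_S[OF A'(1)] card_S n by simp
    then show "?g y = F (part_down1 ?k (cycle_type p A))"
      using F[OF A'(1)] A'(2) by (simp add: cp_def)
  qed
  also have "\<dots> = (?k - 1) * F (part_down1 ?k (cycle_type p A))"
    using O(2) finite_orbit_p by simp
  also have "sum ?g (A - ?O) = (\<Sum>y\<in>A - ?O. F (part_down2 ?k (card (orbit p y)) (cycle_type p A)))"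
  proof (rule sum.cong[OF refl])
    fix y assume y: "y \<in> A - ?O"
    then obtain A' where A': "coloured_matchings (S - {x, y}) A' (contract x y M) (contract x y N)"
      "cycle_type (cp x y) A' = part_down2 ?k (card (orbit p y)) (cycle_type p A)"
      using contract_same_colour_join[OF x, of y] by auto
    have "x \<noteq> y" "x \<in> S" "y \<in> S" using y x sub O by auto
    then have "card (S - {x, y}) = card S - 2" by (simp add: card_Diff_subset)
    then have "card A' = n" using coloured_matchings.card_S[OF A'(1)] card_S n by simp
    then show "?g y = F (part_down2 ?k (card (orbit p y)) (cycle_type p A))"
      using F[OF A'(1)] A'(2) by (simp add: cp_def)
  qed
  also note sum_outside_orbit[OF x, of F]
  finally show ?thesis
    unfolding cut_join_unoriented_def cut_join_def mult_2 by (simp only: ac_simps)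
qed

end

section \<open>Induction on the number of edges\<close>

lemma part_orbit:
  assumes "k \<in># cycle_type p A"
  obtains x where "x \<in> A" "card (orbit p x) = k"
  using assms finA that by (auto simp: cycle_type_def)

text \<open>Two vertices carry only one matching, so \<open>L\<close>, \<open>M\<close> and
  \<open>N\<close> coincide.\<close>

lemma joint_base:
  assumes "card A = 1" and "\<And>z. z \<in> S \<Longrightarrow> R z (M z)"
  shows "card (joint R S M N) = 1"
proof -
  have S2: "card S = 2" using card_S assms(1) by simp
  have uniq: "L = L'" if L: "matching S L" and L': "matching S L'" for L L'
  proof
    fix z show "L z = L' z"
    proof (cases "z \<in> S")
      case True
      have "card (S - {z}) = 1" using True S2 fin by simp
      moreover have "L z \<in> S - {z}" "L' z \<in> S - {z}"
        using True matching_mem[OF L] matching_mem[OF L'] matching_neq[OF L] matching_neq[OF L'] by auto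
      ultimately show ?thesis by (metis card_1_singletonE singletonD)
    qed (simp add: matching_outside[OF L] matching_outside[OF L'])
  qed
  have "hamiltonian S M M"
    unfolding hamiltonian_def
  proof (intro allI impI)
    fix T assume T: "T \<subseteq> S" "T \<noteq> {}" "M ` T \<subseteq> T"
    then obtain z where z: "z \<in> T" by blast
    then have "{z, M z} \<subseteq> T" "M z \<noteq> z" using T matching_neq[OF M] by auto
    then have "2 \<le> card T" using card_mono[of T "{z, M z}"] finite_subset[OF T(1) fin] by auto
    then show "T = S" using T(1) S2 fin by (metis card_mono card_subset_eq le_antisym)
  qed
  then have "M \<in> joint R S M N"
    using M assms(2) unfolding joint_def uniq[OF N M] by simp
  moreover have "L = M" if "L \<in> joint R S M N" for L
    by (rule uniq[OF _ M]) (use that in \<open>simp add: joint_def\<close>)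
  ultimately have "joint R S M N = {M}" by blast
  then show ?thesis by simp
qed

end

text \<open>The step holds for every vertex \<open>x\<close>, hence for every part of the type.
  Letting \<open>SOME\<close> pick a part from the type alone makes the right-hand side a function
  of the type, and no agreement between different parts has to be proved beforehand.\<close>

lemma card_joint_depends_on_type:
  assumes base: "\<And>S A M N. coloured_matchings S A M N \<Longrightarrow> card A = 1 \<Longrightarrow> card (joint (R A) S M N) = 1"
    and step: "\<And>n F S A M N x. coloured_matchings S A M N \<Longrightarrow> x \<in> A \<Longrightarrow> card A = Suc n \<Longrightarrow> 1 \<le> n \<Longrightarrow>
      (\<And>S' A' M' N'. coloured_matchings S' A' M' N' \<Longrightarrow> card A' = n \<Longrightarrow>
        card (joint (R A') S' M' N') = F (cycle_type (M' \<circ> N') A')) \<Longrightarrow>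
      card (joint (R A) S M N) = G F (card (orbit (M \<circ> N) x)) (cycle_type (M \<circ> N) A)"
    and "1 \<le> n"
  shows "\<exists>F. \<forall>S A M N. coloured_matchings S A M N \<longrightarrow> card A = n \<longrightarrow>
    card (joint (R A) S M N) = F (cycle_type (M \<circ> N) A)"
  using \<open>1 \<le> n\<close>
proof (induction n rule: nat_induct_at_least)
  case base
  show ?case using assms(1) by (intro exI[of _ "\<lambda>_. 1"]) auto
next
  case (Suc n)
  then obtain F where F: "\<And>S A M N. coloured_matchings S A M N \<Longrightarrow> card A = n \<Longrightarrow>
    card (joint (R A) S M N) = F (cycle_type (M \<circ> N) A)" by blast
  show ?case
  proof (intro exI[of _ "\<lambda>lam. G F (SOME k. k \<in># lam) lam"] allI impI)
    fix S A M N assume q: "coloured_matchings S A M N" and n: "card A = Suc n"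
    then interpret coloured_matchings S A M N by simp
    have "cycle_type p A \<noteq> {#}" using sum_type n by auto
    then have "(SOME k. k \<in># cycle_type p A) \<in># cycle_type p A" by (metis multiset_nonemptyE someI)
    then obtain x where "x \<in> A" "card (orbit p x) = (SOME k. k \<in># cycle_type p A)"
      by (rule part_orbit)
    then show "card (joint (R A) S M N) = G F (SOME k. k \<in># cycle_type p A) (cycle_type p A)"
      using step[OF q _ n Suc(1) F] by metis
  qed
qed

lemma opposite_depends_on_type:
  assumes "1 \<le> n"
  shows "\<exists>F. \<forall>S A M N. coloured_matchings S A M N \<longrightarrow> card A = n \<longrightarrow>
    card (joint (opposite A) S M N) = F (cycle_type (M \<circ> N) A)"
proof (rule card_joint_depends_on_type[where G = cut_join and R = opposite, OF _ _ assms])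
  show "card (joint (opposite A) S M N) = 1" if "coloured_matchings S A M N" "card A = 1" for S A M N
    using coloured_matchings.joint_base[OF that] coloured_matchings.Mcol[OF that(1)] by simp
qed (erule (3) coloured_matchings.card_joint_opposite)

lemma unrestricted_depends_on_type:
  assumes "1 \<le> n"
  shows "\<exists>F. \<forall>S A M N. coloured_matchings S A M N \<longrightarrow> card A = n \<longrightarrow>
    card (joint unrestricted S M N) = F (cycle_type (M \<circ> N) A)"
proof (rule card_joint_depends_on_type[where G = cut_join_unoriented and R = "\<lambda>_. unrestricted", OF _ _ assms])
  show "card (joint unrestricted S M N) = 1" if "coloured_matchings S A M N" "card A = 1" for S A M N
    using coloured_matchings.joint_base[OF that] by simp
qed (erule (3) coloured_matchings.card_joint_unrestricted)

section \<open>Permutations and double cosets as matchings\<close>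

text \<open>Ensures that the fixed permutation chosen in \<open>c_coef\<close> exists. A new part
  \<open>k\<close> is realised by a cyclic shift of the block \<open>{m..<m + k}\<close>, which is a
  cycle only if it is nonempty.\<close>

lemma ex_permutation_of_type:
  assumes "\<forall>x\<in>#lam. x > 0"
  shows "\<exists>s. s permutes {..<sum_mset lam} \<and> cycle_type s {..<sum_mset lam} = lam"
  using assms
proof (induction lam)
  case empty
  show ?case by (auto simp: permutes_def)
next
  case (add k lam)
  define m where "m = sum_mset lam"
  obtain s where s: "s permutes {..<m}" "cycle_type s {..<m} = lam"
    using add unfolding m_def by auto
  have k: "0 < k" using add.prems by simp
  define t where "t z = (if z < m then s z else if Suc z < m + k then Suc z else if z < m + k then m else z)" for z
  have t1: "t z = s z" if "z \<in> {..<m}" for z using that by (simp add: t_def)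
  have s_im: "s ` {..<m} = {..<m}" using s(1) by (rule permutes_image)
  have t_im: "t ` {..<m} = {..<m}"
    using s_im t1 by (metis image_cong)
  have chain: "(\<lambda>i. m + i) ` {..<k} = {m..<m + k}"
    by (simp add: lessThan_atLeast0 add.commute)
  have "cyclic_on t ((\<lambda>i. m + i) ` {..<k})"
    by (rule cyclic_onI_chain) (use k in \<open>auto simp: t_def\<close>)
  then have cyc: "cyclic_on t {m..<m + k}" by (simp only: chain)
  have sets: "{..<m} \<union> {m..<m + k} = {..<m + k}" by auto
  have fin_im: "t ` {m..<m + k} \<subseteq> {m..<m + k}" using cyclic_on_inI[OF cyc] by blast
  have inj: "inj_on t {..<m + k}"
  proof (rule inj_onI)
    fix z w assume zw: "z \<in> {..<m + k}" "w \<in> {..<m + k}" "t z = t w"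
    have side: "t v < m \<longleftrightarrow> v < m" if "v \<in> {..<m + k}" for v
    proof (cases "v < m")
      case True
      then show ?thesis using t_im by blast
    next
      case False
      then have "v \<in> {m..<m + k}" using that by simp
      then have "t v \<in> {m..<m + k}" using fin_im by blast
      then show ?thesis using False by simp
    qed
    show "z = w"
    proof (cases "z < m")
      case True
      then show ?thesis
        using side zw t1 permutes_inj[OF s(1)] by (metis injD lessThan_iff)
    next
      case False
      then have "\<not> w < m" using side zw by metis
      then show ?thesis using False zw by (auto simp: t_def split: if_splits)
    qed
  qed
  have "t ` {..<m + k} \<subseteq> {..<m + k}"
    using t_im fin_im unfolding sets[symmetric] image_Un by auto
  then have "bij_betw t {..<m + k} {..<m + k}"
    using inj by (simp add: bij_betw_def endo_inj_surj)
  then have perm: "t permutes {..<m + k}" by (rule bij_imp_permutes) (simp add: t_def)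
  have "cycle_type t ({..<m} \<union> {m..<m + k}) = cycle_type t {..<m} + cycle_type t {m..<m + k}"
    using t_im fin_im by (intro cycle_type_Un) auto
  also have "cycle_type t {..<m} = lam"
    using cycle_type_cong[of t "{..<m}" s] t_im t1 s(2) by simp
  also have "cycle_type t {m..<m + k} = {#k#}"
    using cycle_type_cyclic[OF cyc] by simp
  finally have "cycle_type t {..<m + k} = add_mset k lam" by (simp add: sets)
  moreover have "sum_mset (add_mset k lam) = m + k" by (simp add: m_def)
  ultimately show ?case using perm by metis
qed

lemma hamiltonian_commute: "hamiltonian S M N \<longleftrightarrow> hamiltonian S N M"
  unfolding hamiltonian_def by metis

lemma matching_fstar: "matching {..<2 * m} (fstar m)"
  by (rule matchingI) (auto simp: fstar_def)

lemma fstar_less_iff: "z < 2 * m \<Longrightarrow> fstar m z < m \<longleftrightarrow> \<not> z < m"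
  by (auto simp: fstar_def)

section \<open>Permutations as matchings between the points and their hats\<close>

definition double :: "nat \<Rightarrow> (nat \<Rightarrow> nat) \<Rightarrow> nat \<Rightarrow> nat" where
  "double m s z = (if z < m then s z + m else if z < 2 * m then inv s (z - m) else z)"

lemma matching_double:
  assumes "s permutes {..<m}"
  shows "matching {..<2 * m} (double m s)"
proof (rule matchingI)
  have lt: "s z < m \<longleftrightarrow> z < m" "inv s z < m \<longleftrightarrow> z < m" for z
    using permutes_in_image[OF assms, of z] permutes_in_image[OF permutes_inv[OF assms], of z] by auto
  fix z assume z: "z \<in> {..<2 * m}"
  show "double m s z \<in> {..<2 * m} \<and> double m s z \<noteq> z \<and> double m s (double m s z) = z"
  proof (cases "z < m")
    case True
    then have "s z < m" using lt by simp
    then show ?thesis using True by (simp add: double_def permutes_inverses[OF assms])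
  next
    case False
    then have "inv s (z - m) < m" using z lt by auto
    then show ?thesis using False z by (auto simp: double_def permutes_inverses[OF assms])
  qed
qed (simp add: double_def)

lemma double_less_iff:
  assumes "s permutes {..<m}" "z < 2 * m"
  shows "double m s z < m \<longleftrightarrow> \<not> z < m"
  using assms permutes_in_image[OF permutes_inv[OF assms(1)], of "z - m"] by (auto simp: double_def)

lemma coloured_fstar_double:
  assumes "s permutes {..<m}"
  shows "coloured_matchings {..<2 * m} {..<m} (fstar m) (double m s)"
  using matching_fstar matching_double[OF assms] fstar_less_iff double_less_iff[OF assms]
  by unfold_locales auto

lemma coloured_double_double:
  assumes "s permutes {..<m}" "t permutes {..<m}"
  shows "coloured_matchings {..<2 * m} {..<m} (double m s) (double m t)"
  using matching_double[OF assms(1)] matching_double[OF assms(2)] double_less_iff[OF assms(1)] double_less_iff[OF assms(2)]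
  by unfold_locales auto

lemma cycle_type_fstar_double:
  assumes "s permutes {..<m}"
  shows "cycle_type (fstar m \<circ> double m s) {..<m} = cycle_type s {..<m}"
proof (rule cycle_type_cong[symmetric])
  show "s ` {..<m} \<subseteq> {..<m}" using permutes_image[OF assms] by simp
  show "s z = (fstar m \<circ> double m s) z" if "z \<in> {..<m}" for z
    using that permutes_in_image[OF assms, of z] by (simp add: fstar_def double_def)
qed

text \<open>If \<open>t = s \<circ> s2\<close>, then \<open>inv s \<circ> t\<close> is
  \<open>s2\<close>: comparing the matchings of \<open>s\<close> and \<open>t\<close> reads off the
  second factor.\<close>

lemma cycle_type_double_double:
  assumes "s permutes {..<m}" "t permutes {..<m}"
  shows "cycle_type (double m s \<circ> double m t) {..<m} = cycle_type (inv s \<circ> t) {..<m}"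
proof (rule cycle_type_cong[symmetric])
  have p: "inv s \<circ> t permutes {..<m}"
    using assms permutes_compose permutes_inv by blast
  show "(inv s \<circ> t) ` {..<m} \<subseteq> {..<m}" using permutes_image[OF p] by simp
  show "(inv s \<circ> t) z = (double m s \<circ> double m t) z" if "z \<in> {..<m}" for z
    using that permutes_in_image[OF assms(2), of z] by (simp add: double_def)
qed

lemma ex_double:
  assumes L: "matching {..<2 * m} L" and opp: "\<And>z. z < 2 * m \<Longrightarrow> L z < m \<longleftrightarrow> \<not> z < m"
  shows "\<exists>s. s permutes {..<m} \<and> L = double m s"
proof -
  define s where "s z = (if z < m then L z - m else z)" for z
  have Lm: "L z < 2 * m \<longleftrightarrow> z < 2 * m" for z using matching_mem[OF L, of z] by simp
  have ge: "m \<le> L z" if "z < m" for z using opp[of z] that by (simp add: not_less)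
  have inj: "inj_on s {..<m}"
  proof (rule inj_onI)
    fix z w assume zw: "z \<in> {..<m}" "w \<in> {..<m}" "s z = s w"
    then have "L z = L w" using ge[of z] ge[of w] by (simp add: s_def)
    then show "z = w" using matching_invol[OF L] by metis
  qed
  have "s ` {..<m} \<subseteq> {..<m}"
  proof (rule image_subsetI)
    fix z assume "z \<in> {..<m}"
    then show "s z \<in> {..<m}" using Lm[of z] ge[of z] by (simp add: s_def)
  qed
  then have "bij_betw s {..<m} {..<m}" using inj by (simp add: bij_betw_def endo_inj_surj)
  then have s: "s permutes {..<m}" by (rule bij_imp_permutes) (simp add: s_def)
  have sL: "s z + m = L z" if "z < m" for z using that ge[of z] by (simp add: s_def)
  have "L z = double m s z" for z
  proof -
    consider "z < m" | "m \<le> z" "z < 2 * m" | "2 * m \<le> z" by linarith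
    then show ?thesis
    proof cases
      case 1
      then show ?thesis using sL by (simp add: double_def)
    next
      case 2
      then have "L z < m" using opp[of z] by simp
      then have "s (L z) + m = z" using sL[of "L z"] matching_invol[OF L] by simp
      then have "inv s (z - m) = L z" using permutes_inverses(2)[OF s, of "L z"] by (metis add_diff_cancel_right')
      then show ?thesis using 2 by (simp add: double_def)
    next
      case 3
      then show ?thesis using matching_outside[OF L, of z] by (simp add: double_def)
    qed
  qed
  then show ?thesis using s by blast
qed

lemma inj_double: "inj_on (double m) {s. s permutes {..<m}}"
proof (rule inj_onI)
  fix s t assume st: "s \<in> {s. s permutes {..<m}}" "t \<in> {s. s permutes {..<m}}" "double m s = double m t"
  show "s = t"
  proof
    fix z show "s z = t z"
    proof (cases "z < m")
      case True
      then show ?thesis using fun_cong[OF st(3), of z] by (simp add: double_def)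
    next
      case False
      then show ?thesis using st(1,2) by (metis lessThan_iff mem_Collect_eq permutes_not_in)
    qed
  qed
qed

text \<open>The first factor determines the second, so a factorisation is one permutation subject to
  two conditions.\<close>

lemma card_factorizations:
  assumes "t permutes U"
  shows "card {(s1, s2). s1 permutes U \<and> s2 permutes U \<and> P s1 \<and> Q s2 \<and> s1 \<circ> s2 = t} =
    card {s. s permutes U \<and> P s \<and> Q (inv s \<circ> t)}" (is "card ?X = card ?Y")
proof -
  have e: "inv s1 \<circ> (s1 \<circ> s2) = s2" if "s1 permutes U" for s1 s2 :: "'a \<Rightarrow> 'a"
    using that by (simp add: fun_eq_iff permutes_inverses)
  have "bij_betw (\<lambda>s. (s, inv s \<circ> t)) ?Y ?X"
  proof (rule bij_betw_byWitness[where f' = fst])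
    show "(\<lambda>s. (s, inv s \<circ> t)) ` ?Y \<subseteq> ?X"
      using assms by (auto simp: permutes_compose permutes_inv fun_eq_iff permutes_inverses)
    show "\<forall>a\<in>?X. (fst a, inv (fst a) \<circ> t) = a" using e by auto
    show "fst ` ?X \<subseteq> ?Y" using e by auto
  qed auto
  from bij_betw_same_card[OF this] show ?thesis by (rule sym)
qed

text \<open>One pair of matchings of the right type suffices, because the count is already known to
  depend on the type alone. The pair used belongs to the identity and to the permutation that
  \<open>SOME\<close> picks.\<close>

lemma c_coef_eq_card_joint:
  assumes "\<forall>x\<in>#lam. x > 0" "sum_mset lam = m" "1 \<le> m"
  shows "\<exists>S A M N. coloured_matchings S A M N \<and> card A = m \<and> cycle_type (M \<circ> N) A = lam \<and>
    c_coef lam = card (joint (opposite A) S M N)"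
proof -
  define t where "t = (SOME s. s permutes {..<m} \<and> cycle_type s {..<m} = lam)"
  have "\<exists>s. s permutes {..<m} \<and> cycle_type s {..<m} = lam"
    using ex_permutation_of_type[OF assms(1)] assms(2) by simp
  from someI_ex[OF this] have t: "t permutes {..<m}" "cycle_type t {..<m} = lam"
    unfolding t_def[symmetric] by auto
  define Q where "Q = {s. s permutes {..<m} \<and> cycle_type s {..<m} = {#m#} \<and> cycle_type (inv s \<circ> t) {..<m} = {#m#}}"
  have ne: "{..<m} \<noteq> {}" using assms(3) by (simp add: lessThan_empty_iff)
  have Q_iff: "hamiltonian {..<2 * m} (fstar m) (double m s) \<and> hamiltonian {..<2 * m} (double m t) (double m s)
      \<longleftrightarrow> s \<in> Q" if "s permutes {..<m}" for s
    using coloured_matchings.hamiltonian_iff[OF coloured_fstar_double[OF that] ne]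
      coloured_matchings.hamiltonian_iff[OF coloured_double_double[OF that t(1)] ne]
      cycle_type_fstar_double[OF that] cycle_type_double_double[OF that t(1)] that
    by (simp add: Q_def hamiltonian_commute[of _ "double m t"])
  have "joint (opposite {..<m}) {..<2 * m} (fstar m) (double m t) = double m ` Q"
  proof (intro set_eqI iffI)
    fix L assume L: "L \<in> joint (opposite {..<m}) {..<2 * m} (fstar m) (double m t)"
    then obtain s where "s permutes {..<m}" "L = double m s"
      using ex_double[of m L] by (auto simp: joint_def)
    then show "L \<in> double m ` Q" using Q_iff[of s] L by (auto simp: joint_def)
  next
    fix L assume "L \<in> double m ` Q"
    then obtain s where s: "s \<in> Q" "L = double m s" by blast
    then have sp: "s permutes {..<m}" by (simp add: Q_def)
    show "L \<in> joint (opposite {..<m}) {..<2 * m} (fstar m) (double m t)"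
      using Q_iff[OF sp] s matching_double[OF sp] double_less_iff[OF sp] by (auto simp: joint_def)
  qed
  moreover have "inj_on (double m) Q" by (rule inj_on_subset[OF inj_double]) (auto simp: Q_def)
  ultimately have "card (joint (opposite {..<m}) {..<2 * m} (fstar m) (double m t)) = card Q"
    by (simp add: card_image)
  moreover have "c_coef lam = card Q"
    unfolding Q_def c_coef_def Let_def assms(2) t_def[symmetric] by (rule card_factorizations[OF t(1)])
  ultimately show ?thesis
    using coloured_fstar_double[OF t(1)] cycle_type_fstar_double[OF t(1)] t(2)
    by (intro exI[of _ "{..<2 * m}"] exI[of _ "{..<m}"] exI[of _ "fstar m"] exI[of _ "double m t"]) simp
qed

text \<open>A maximal invariant set without an edge of \<^term>\<open>M\<close> inside is a colour class: otherwise a further orbit of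
  \<^term>\<open>M \<circ> N\<close> could be added, because \<^term>\<open>M\<close> never maps a point into its own orbit.\<close>

lemma ex_colouring:
  fixes S :: "nat set"
  assumes fin: "finite S" and M: "matching S M" and N: "matching S N"
  shows "\<exists>A. coloured_matchings S A M N"
proof -
  let ?p = "M \<circ> N"
  note Mf = matching_invol[OF M] matching_mem[OF M] matching_neq[OF M]
  note Nf = matching_invol[OF N] matching_mem[OF N] matching_neq[OF N]
  have perm: "?p permutes S" using M N by (simp add: matching_permutes permutes_compose)
  have cyc: "cyclic_on ?p (orbit ?p u)" for u using perm fin by (rule cyclic_on_orbit)
  have self: "u \<in> orbit ?p u" for u
    by (rule permutation_self_in_orbit[OF permutes_imp_permutation[OF fin perm]])
  \<comment> \<open>Descent by two: applying the involutions to \<open>p^(i+2) u = M u\<close> gives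
    \<open>p^i (p u) = N u = M (p u)\<close>, the same situation for \<open>p u\<close>. The cases 0
    and 1 fail because neither \<open>M\<close> nor \<open>N\<close> fixes \<open>u\<close>.\<close>
  have pow: "(?p ^^ i) u \<noteq> M u" if "u \<in> S" for i u
    using that
  proof (induction i arbitrary: u rule: nat_induct2)
    case 0
    then show ?case using Mf(3)[of u] by (metis funpow_0)
  next
    case 1
    then have "M (N u) \<noteq> M u" using Nf(3)[of u] Mf(1) by metis
    then show ?case by simp
  next
    case (step i)
    have pS: "?p u \<in> S" using step.prems Mf(2) Nf(2) by simp
    show ?case
    proof
      assume "(?p ^^ (i + 2)) u = M u"
      then have "?p ((?p ^^ i) (?p u)) = M u"
        by (metis add_2_eq_Suc' comp_apply funpow.simps(2) funpow_swap1)
      then have "N ((?p ^^ i) (?p u)) = u" by (metis Mf(1) comp_apply)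
      then have "(?p ^^ i) (?p u) = N u" by (metis Nf(1))
      also have "N u = M (?p u)" using Mf(1) by simp
      finally show False using step.IH[OF pS] by blast
    qed
  qed
  have Morb: "M u \<notin> orbit ?p u" if "u \<in> S" for u
    using pow[OF that] by (auto simp: orbit_altdef) metis
  define \<F> where "\<F> = {A. A \<subseteq> S \<and> ?p ` A \<subseteq> A \<and> (\<forall>z\<in>A. M z \<notin> A)}"
  have "finite \<F>" by (rule finite_subset[of _ "Pow S"]) (use fin in \<open>auto simp: \<F>_def\<close>)
  moreover have "{} \<in> \<F>" by (simp add: \<F>_def)
  ultimately obtain A where A: "A \<in> \<F>" and max: "\<And>B. B \<in> \<F> \<Longrightarrow> A \<subseteq> B \<Longrightarrow> A = B"
    using finite_has_maximal[of \<F>] by blast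
  then have A': "A \<subseteq> S" "?p ` A \<subseteq> A" "\<And>z. z \<in> A \<Longrightarrow> M z \<notin> A" by (auto simp: \<F>_def)
  have pre: "u \<in> A" if "?p u \<in> A" for u
  proof -
    have "orbit ?p (?p u) \<subseteq> A" using A'(2) that by (rule orbit_subset_invariant)
    moreover have "orbit ?p (?p u) = orbit ?p u" by (rule self_in_orbit_step[OF self])
    ultimately show ?thesis using self by blast
  qed
  have "S \<subseteq> A \<union> M ` A"
  proof
    fix u assume u: "u \<in> S"
    show "u \<in> A \<union> M ` A"
    proof (rule ccontr)
      assume nu: "u \<notin> A \<union> M ` A"
      let ?O = "orbit ?p u"
      have OS: "?O \<subseteq> S" using perm u by (rule permutes_orbit_subset)
      have dO: "\<not> z \<in> A" if "z \<in> ?O" for z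
      proof
        assume "z \<in> A"
        then have "orbit ?p z \<subseteq> A" using A'(2) by (intro orbit_subset_invariant)
        moreover have "orbit ?p z = ?O" using cyc that by (rule orbit_cyclic_eq3)
        ultimately show False using nu self by blast
      qed
      \<comment> \<open>An edge of \<open>M\<close> from the orbit of \<open>u\<close> into
        \<open>A\<close> would propagate along the whole orbit and put \<open>M u\<close> into
        \<open>A\<close>, against the choice of \<open>u\<close>.\<close>
      have MA_inv: "M (?p z) \<in> A" if "M z \<in> A" for z
      proof -
        have "?p (M (?p z)) = M z" using Mf(1) Nf(1) by simp
        then show ?thesis using pre[of "M (?p z)"] that by simp
      qed
      have MO: "M z \<notin> A" if "z \<in> ?O" for z
      proof
        assume "M z \<in> A"
        have "orbit ?p z \<subseteq> {z. M z \<in> A}"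
          using MA_inv \<open>M z \<in> A\<close> by (intro orbit_subset_invariant) auto
        moreover have "orbit ?p z = ?O" using cyc that by (rule orbit_cyclic_eq3)
        ultimately have "M u \<in> A" using self by blast
        then show False using nu Mf(1)[of u] by force
      qed
      have MOO: "M z \<notin> ?O" if "z \<in> ?O" for z
        using Morb[of z] orbit_cyclic_eq3[OF cyc that] OS that by auto
      have "?p z \<in> ?O" if "z \<in> ?O" for z using cyc that by (rule cyclic_on_inI)
      moreover have "M z \<notin> ?O" if "z \<in> A" for z
        using MO[of "M z"] Mf(1)[of z] that by auto
      ultimately have "A \<union> ?O \<in> \<F>"
        using A' OS MO MOO unfolding \<F>_def by blast
      then show False using max[of "A \<union> ?O"] dO self by blast
    qed
  qed
  moreover have "M ` A \<subseteq> S" using A'(1) Mf(2) by auto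
  ultimately have "S = A \<union> M ` A" using A'(1) by blast
  moreover have "A \<inter> M ` A = {}" using A'(3) by blast
  moreover have "inj_on M A" using Mf(1) by (metis inj_onI)
  moreover have "finite A" using A'(1) fin by (rule finite_subset)
  ultimately have "card S = 2 * card A" by (simp add: card_Un_disjoint card_image)
  then show ?thesis using coloured_matchingsI[OF fin A'(1) M N A'(2,3)] by blast
qed


section \<open>Double cosets and the matchings w f w^-1\<close>

lemma multiset_double_eq_iff: "X + X = Y + Y \<longleftrightarrow> X = (Y :: 'a multiset)"
proof
  assume eq: "X + X = Y + Y"
  show "X = Y"
  proof (rule multiset_eqI)
    fix a
    have "count (X + X) a = count (Y + Y) a" by (simp only: eq)
    then show "count X a = count Y a" by simp
  qed
qed simp

text \<open>The form that mentions no colouring, as in the definition of K_(m), where the cycle type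
  is taken on all 2m points.\<close>

lemma hamiltonian_iff_cycle_type:
  fixes S :: "nat set"
  assumes "finite S" "matching S M" "matching S N" "card S = 2 * m" "1 \<le> m"
  shows "hamiltonian S M N \<longleftrightarrow> cycle_type (M \<circ> N) S = {#m#} + {#m#}"
proof -
  obtain A where "coloured_matchings S A M N" using ex_colouring[OF assms(1-3)] by blast
  then interpret coloured_matchings S A M N .
  have cA: "card A = m" using card_S assms(4) by simp
  then have "A \<noteq> {}" using assms(5) by auto
  then show ?thesis using hamiltonian_iff cA unfolding cycle_type_S multiset_double_eq_iff by simp
qed

lemma matching_conj:
  assumes L: "matching S L" and w: "w permutes S"
  shows "matching S (w \<circ> L \<circ> inv w)"
proof (rule matchingI)
  have iw: "inv w z \<in> S \<longleftrightarrow> z \<in> S" for z using permutes_in_image[OF permutes_inv[OF w]] .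
  show "(w \<circ> L \<circ> inv w) z = z" if "z \<notin> S" for z
    using that iw matching_outside[OF L] by (simp add: permutes_inverses[OF w])
  fix z assume z: "z \<in> S"
  have "L (inv w z) \<noteq> inv w z" using matching_neq[OF L] iw z by blast
  then have "w (L (inv w z)) \<noteq> z" by (metis permutes_inverses(2)[OF w])
  then show "(w \<circ> L \<circ> inv w) z \<in> S \<and> (w \<circ> L \<circ> inv w) z \<noteq> z \<and> (w \<circ> L \<circ> inv w) ((w \<circ> L \<circ> inv w) z) = z"
    using z iw matching_mem[OF L] matching_invol[OF L] permutes_in_image[OF w]
    by (simp add: permutes_inverses[OF w])
qed

text \<open>These \<open>w\<close> form a coset of the centralizer of \<open>fstar m\<close>, whence
  the order of the hyperoctahedral group. They are counted directly: \<open>w\<close> is determined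
  by the edge of \<open>L\<close> assigned to each \<open>i < m\<close> (the permutation
  \<open>s\<close>) and by the set \<open>E\<close> of those \<open>i\<close> that go to the end
  outside \<open>A\<close>.\<close>

lemma card_conjugators:
  assumes L: "matching {..<2 * m} L"
  shows "card {w. w permutes {..<2 * m} \<and> w \<circ> fstar m \<circ> inv w = L} = 2 ^ m * fact m"
proof -
  \<comment> \<open>A colouring of the pair \<open>L\<close>, \<open>L\<close> selects one end of
    every edge of \<open>L\<close>.\<close>
  obtain A where "coloured_matchings {..<2 * m} A L L" using ex_colouring[OF _ L L] by auto
  then interpret coloured_matchings "{..<2 * m}" A L L .
  have cA: "card A = m" using card_S by simp
  have LA: "L z \<notin> A" if "z \<in> A" for z using that Mcol[of z] sub by auto
  have AS: "z < 2 * m" if "z \<in> A" for z using that sub by auto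
  obtain e where e: "bij_betw e {..<m} A"
    using finA cA by (metis bij_betw_iff_card finite_lessThan card_lessThan)
  have eA: "e z \<in> A" if "z < m" for z using e that by (auto simp: bij_betw_def)
  have einj: "e z = e w \<longleftrightarrow> z = w" if "z < m" "w < m" for z w
    using e that by (auto simp: bij_betw_def inj_on_def)
  let ?B = "{w. w permutes {..<2 * m} \<and> w \<circ> fstar m \<circ> inv w = L}"
  let ?D = "{s. s permutes {..<m}} \<times> Pow {..<m}"
  define u where "u s E z = (if z \<in> E then L (e (s z)) else e (s z))" for s :: "nat \<Rightarrow> nat" and E and z :: nat
  define W where "W = (\<lambda>(s, E) z. if z < m then u s E z else if z < 2 * m then L (u s E (z - m)) else z)"
  have uA: "u s E z \<in> A \<longleftrightarrow> z \<notin> E" if "s permutes {..<m}" "z < m" for s E z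
    using eA LA permutes_in_image[OF that(1), of z] that(2) by (auto simp: u_def)
  have sm: "s z < m" if "s permutes {..<m}" "z < m" for s z
    using permutes_in_image[OF that(1), of z] that(2) by simp
  have ulist: "u s E z = e (s z) \<or> u s E z = L (e (s z))" for s E z by (simp add: u_def)
  have u_inj: "z = w" if s: "s permutes {..<m}" and zw: "z < m" "w < m" and eq: "u s E z = u s E w \<or> u s E z = L (u s E w)" for s E z w
  proof -
    have "e (s z) = e (s w)"
      using eq ulist[of s E z] ulist[of s E w] LA eA[OF sm[OF s zw(1)]] eA[OF sm[OF s zw(2)]] by (metis MM)
    then show ?thesis using einj[OF sm[OF s zw(1)] sm[OF s zw(2)]] permutes_inj[OF s] by (simp add: inj_eq)
  qed
  have u_lt: "u s E z < 2 * m" if "s permutes {..<m}" "z < m" for s E z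
  proof -
    have "e (s z) < 2 * m" using AS eA sm that by blast
    then show ?thesis using MS[of "e (s z)"] by (simp add: u_def)
  qed
  \<comment> \<open>Conjugating \<open>fstar m\<close> to \<open>L\<close> means sending each pair
    \<open>z\<close>, \<open>z + m\<close> to an edge of \<open>L\<close>. As both maps are
    involutions, one end of each pair is enough.\<close>
  have conj_iff: "w \<circ> fstar m \<circ> inv w = L \<longleftrightarrow> (\<forall>z<m. w (z + m) = L (w z))" if w: "w permutes {..<2 * m}" for w
  proof
    assume "w \<circ> fstar m \<circ> inv w = L"
    then have "L (w z) = (w \<circ> fstar m \<circ> inv w) (w z)" for z by simp
    then have "L (w z) = w (fstar m z)" for z by (simp add: permutes_inverses(2)[OF w])
    then show "\<forall>z<m. w (z + m) = L (w z)" by (simp add: fstar_def)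
  next
    assume H: "\<forall>z<m. w (z + m) = L (w z)"
    have "w (fstar m z) = L (w z)" for z
    proof -
      consider "z < m" | "m \<le> z" "z < 2 * m" | "2 * m \<le> z" by linarith
      then show ?thesis
      proof cases
        case 1
        then show ?thesis using H by (simp add: fstar_def)
      next
        case 2
        then have "w z = L (w (z - m))" using H[rule_format, of "z - m"] by simp
        then show ?thesis using 2 by (simp add: fstar_def)
      next
        case 3
        then have "w z = z" using permutes_not_in[OF w, of z] by simp
        then show ?thesis using 3 matching_outside[OF L, of z] by (simp add: fstar_def)
      qed
    qed
    then show "w \<circ> fstar m \<circ> inv w = L" by (simp add: fun_eq_iff permutes_inverses[OF w])
  qed
  have W_in: "W (s, E) \<in> ?B" if s: "s permutes {..<m}" for s E
  proof -
    define w where "w = W (s, E)"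
    define r where "r z = (if z < m then z else z - m)" for z
    have r: "r z < m" "w z = (if z < m then u s E (r z) else L (u s E (r z)))" if "z < 2 * m" for z
      using that by (auto simp: r_def w_def W_def)
    have "inj_on w {..<2 * m}"
    proof (rule inj_onI)
      fix z z' assume z: "z \<in> {..<2 * m}" "z' \<in> {..<2 * m}" "w z = w z'"
      then have lt: "z < 2 * m" "z' < 2 * m" by auto
      have "u s E (r z) = u s E (r z') \<or> u s E (r z) = L (u s E (r z'))"
        using z(3) r(2)[OF lt(1)] r(2)[OF lt(2)] by (metis MM)
      then have rr: "r z = r z'" using u_inj[OF s r(1)[OF lt(1)] r(1)[OF lt(2)]] by blast
      have "L (u s E (r z)) \<noteq> u s E (r z)"
        using matching_neq[OF L] u_lt[OF s r(1)[OF lt(1)]] by simp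
      then have "z < m \<longleftrightarrow> z' < m" using z(3) r(2)[OF lt(1)] r(2)[OF lt(2)] rr by (metis)
      then show "z = z'" using rr by (auto simp: r_def split: if_splits)
    qed
    moreover have "w ` {..<2 * m} \<subseteq> {..<2 * m}"
    proof (rule image_subsetI)
      fix z assume "z \<in> {..<2 * m}"
      then show "w z \<in> {..<2 * m}"
        using r[of z] u_lt[OF s, of "r z"] MS[of "u s E (r z)"] by simp
    qed
    ultimately have "bij_betw w {..<2 * m} {..<2 * m}" by (simp add: bij_betw_def endo_inj_surj)
    then have w: "w permutes {..<2 * m}" by (rule bij_imp_permutes) (simp add: w_def W_def)
    have "\<forall>z<m. w (z + m) = L (w z)" by (simp add: w_def W_def)
    then show ?thesis using w conj_iff[OF w] by (simp add: w_def)
  qed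
  have "bij_betw W ?D ?B"
    unfolding bij_betw_def
  proof
    show "inj_on W ?D"
    proof (rule inj_onI, clarify)
      fix s E s' E' assume D: "s permutes {..<m}" "E \<subseteq> {..<m}" "s' permutes {..<m}" "E' \<subseteq> {..<m}"
        and eq: "W (s, E) = W (s', E')"
      have ueq: "u s E z = u s' E' z" if "z < m" for z
        using fun_cong[OF eq, of z] that by (simp add: W_def)
      then have "z \<in> E \<longleftrightarrow> z \<in> E'" if "z < m" for z using uA[OF D(1) that] uA[OF D(3) that] that by metis
      then have EE: "E = E'" using D(2,4) by blast
      have "s z = s' z" for z
      proof (cases "z < m")
        case True
        then have "e (s z) = e (s' z)" using ueq[OF True] EE by (auto simp: u_def split: if_splits)
        then show ?thesis using einj sm D(1,3) True by blast
      next
        case False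
        then show ?thesis using D(1,3) by (metis lessThan_iff permutes_not_in)
      qed
      then show "s = s' \<and> E = E'" using EE by auto
    qed
    show "W ` ?D = ?B"
    proof
      show "W ` ?D \<subseteq> ?B" using W_in by auto
      show "?B \<subseteq> W ` ?D"
      proof
        fix w assume "w \<in> ?B"
        then have w: "w permutes {..<2 * m}" and wL: "\<And>z. z < m \<Longrightarrow> w (z + m) = L (w z)"
          using conj_iff by auto
        have wS: "w z < 2 * m \<longleftrightarrow> z < 2 * m" for z using permutes_in_image[OF w, of z] by simp
        have winj: "w z = w z' \<longleftrightarrow> z = z'" for z z' using permutes_inj[OF w] by (simp add: inj_eq)
        define E where "E = {z. z < m \<and> w z \<notin> A}"
        \<comment> \<open>\<open>a z\<close> is the end in \<open>A\<close> of the edge of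
          \<open>L\<close> through \<open>w z\<close>; its number under \<open>e\<close> is the
          value of the sought permutation.\<close>
        define a where "a z = (if z \<in> E then L (w z) else w z)" for z
        have aA: "a z \<in> A" if "z < m" for z
          using that Mcol[of "w z"] wS[of z] by (auto simp: a_def E_def)
        define s where "s z = (if z < m then inv_into {..<m} e (a z) else z)" for z
        have es: "e (s z) = a z" "s z < m" if "z < m" for z
        proof -
          have im: "a z \<in> e ` {..<m}" using aA[OF that] e by (simp add: bij_betw_def)
          show "e (s z) = a z" using f_inv_into_f[OF im] that by (simp add: s_def)
          show "s z < m" using inv_into_into[OF im] that by (simp add: s_def)
        qed
        have "inj_on s {..<m}"
        proof (rule inj_onI)
          fix z z' assume z: "z \<in> {..<m}" "z' \<in> {..<m}" "s z = s z'"
          then have lt: "z < m" "z' < m" by auto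
          then have "a z = a z'" using es(1) z(3) by metis
          then have "w z = w z' \<or> w z = L (w z')" unfolding a_def by (metis MM)
          moreover have "L (w z') = w (z' + m)" using wL[OF lt(2)] by simp
          ultimately show "z = z'" using winj lt by auto
        qed
        moreover have "s ` {..<m} \<subseteq> {..<m}" using es(2) by auto
        ultimately have "bij_betw s {..<m} {..<m}" by (simp add: bij_betw_def endo_inj_surj)
        then have s: "s permutes {..<m}" by (rule bij_imp_permutes) (simp add: s_def)
        have uw: "u s E z = w z" if "z < m" for z
          using es(1)[OF that] by (simp add: u_def a_def)
        have "w z = W (s, E) z" for z
        proof -
          consider "z < m" | "m \<le> z" "z < 2 * m" | "2 * m \<le> z" by linarith
          then show ?thesis
          proof cases
            case 1
            then show ?thesis using uw by (simp add: W_def)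
          next
            case 2
            then show ?thesis using uw[of "z - m"] wL[of "z - m"] by (simp add: W_def)
          next
            case 3
            then show ?thesis using permutes_not_in[OF w, of z] by (simp add: W_def)
          qed
        qed
        then have "w = W (s, E)" by auto
        then show "w \<in> W ` ?D" using s by (auto simp: E_def)
      qed
    qed
  qed
  from bij_betw_same_card[OF this] have "card ?B = card ?D" by (rule sym)
  also have "\<dots> = fact m * 2 ^ m"
  proof -
    have "card {s. s permutes {..<m}} = fact m" by (rule card_permutations) auto
    then show ?thesis by (simp only: card_cartesian_product card_Pow finite_lessThan card_lessThan)
  qed
  finally show ?thesis by simp
qed

text \<open>Whether \<open>s\<close> is an admissible first factor depends only on its matching
  \<open>s \<circ> fstar m \<circ> inv s\<close>, and each matching arises from 2^m m! permutations.
  The division in \<open>bt_coef\<close> thus turns the number of factorisations into a number of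
  matchings.\<close>

lemma bt_coef_eq_card_joint:
  assumes "\<forall>x\<in>#lam. x > 0" "sum_mset lam = m" "1 \<le> m"
  shows "\<exists>S A M N. coloured_matchings S A M N \<and> card A = m \<and> cycle_type (M \<circ> N) A = lam \<and>
    bt_coef lam = real (card (joint unrestricted S M N))"
proof -
  let ?S = "{..<2 * m}" and ?f = "fstar m"
  obtain t where t: "t permutes {..<m}" "cycle_type t {..<m} = lam"
    using ex_permutation_of_type[OF assms(1)] assms(2) by auto
  let ?W = "{w. w permutes ?S \<and> w \<circ> ?f \<circ> inv w = double m t}"
  \<comment> \<open>Some conjugate of \<open>fstar m\<close> is \<open>double m t\<close>. This
    makes the double coset of \<open>lam\<close> nonempty, so that the choice of \<open>w0\<close>
    is meaningful.\<close>
  have "card ?W \<noteq> 0"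
    unfolding card_conjugators[OF matching_double[OF t(1)]] by simp
  then have "?W \<noteq> {}" by (metis card.empty)
  then obtain w1 where w1: "w1 permutes ?S" "w1 \<circ> ?f \<circ> inv w1 = double m t" by blast
  have "cycle_type (?f \<circ> w1 \<circ> ?f \<circ> inv w1) ?S = lam + lam"
    using coloured_matchings.cycle_type_S[OF coloured_fstar_double[OF t(1)]]
      cycle_type_fstar_double[OF t(1)] t(2) w1(2) by (simp add: comp_assoc)
  then have "w1 \<in> Kset m lam" using w1(1) by (simp add: Kset_def)
  define w0 where "w0 = (SOME w. w \<in> Kset m lam)"
  have "\<exists>w. w \<in> Kset m lam" using \<open>w1 \<in> _\<close> by blast
  from someI_ex[OF this] have "w0 \<in> Kset m lam" unfolding w0_def .
  then have w0: "w0 permutes ?S" "cycle_type (?f \<circ> w0 \<circ> ?f \<circ> inv w0) ?S = lam + lam"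
    by (auto simp: Kset_def)
  define c where "c s = s \<circ> ?f \<circ> inv s" for s :: "nat \<Rightarrow> nat"
  have cm: "matching ?S (c s)" if "s permutes ?S" for s
    unfolding c_def using matching_fstar that by (rule matching_conj)
  obtain A where q: "coloured_matchings ?S A ?f (c w0)"
    using ex_colouring[OF _ matching_fstar cm[OF w0(1)]] by auto
  then interpret coloured_matchings ?S A ?f "c w0" .
  have "cycle_type p A + cycle_type p A = lam + lam"
    using w0(2) cycle_type_S by (simp add: c_def comp_assoc)
  then have type: "cycle_type p A = lam" by (simp add: multiset_double_eq_iff)
  have cA: "card A = m" using card_S by simp
  define Q where "Q = {s. s permutes ?S \<and> s \<in> Kset m {#m#} \<and> inv s \<circ> w0 \<in> Kset m {#m#}}"
  have K: "s \<in> Kset m {#m#} \<longleftrightarrow> s permutes ?S \<and> hamiltonian ?S ?f (c s)" for s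
    using hamiltonian_iff_cycle_type[OF _ matching_fstar cm _ assms(3), of s]
    by (auto simp: Kset_def c_def comp_assoc)
  \<comment> \<open>Conjugation by \<open>s\<close> carries the pair \<open>fstar m\<close>,
    \<open>c (inv s \<circ> w0)\<close> to the pair \<open>c s\<close>, \<open>c w0\<close>.\<close>
  have K2: "inv s \<circ> w0 \<in> Kset m {#m#} \<longleftrightarrow> hamiltonian ?S (c w0) (c s)" if s: "s permutes ?S" for s
  proof -
    let ?q = "?f \<circ> (inv s \<circ> w0) \<circ> ?f \<circ> inv (inv s \<circ> w0)"
    have sw: "inv s \<circ> w0 permutes ?S" using permutes_compose[OF w0(1) permutes_inv[OF s]] .
    have "inv (inv s \<circ> w0) = inv w0 \<circ> s"
      by (rule inv_unique_comp) (simp_all add: fun_eq_iff permutes_inverses[OF s] permutes_inverses[OF w0(1)])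
    then have cj: "(c s \<circ> c w0) (s z) = s (?q z)" for z
      by (simp add: c_def permutes_inverses[OF s])
    have qp: "?q permutes ?S"
      using matching_permutes[OF matching_fstar] sw permutes_inv[OF sw] w0(1) permutes_inv[OF s]
      by (intro permutes_compose)
    have "cycle_type (c s \<circ> c w0) (s ` ?S) = cycle_type ?q ?S"
      by (rule cycle_type_conj[OF qp]) (use permutes_image[OF qp] permutes_inj_on[OF s] cj in auto)
    then have "cycle_type ?q ?S = cycle_type (c s \<circ> c w0) ?S" by (simp add: permutes_image[OF s])
    then show ?thesis
      using sw hamiltonian_iff_cycle_type[OF _ cm[OF s] cm[OF w0(1)] _ assms(3)]
      by (simp add: Kset_def hamiltonian_commute[of _ "c w0"])
  qed
  let ?J = "joint unrestricted ?S ?f (c w0)"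
  have Q_eq: "s \<in> Q \<longleftrightarrow> s permutes ?S \<and> c s \<in> ?J" for s
    using K[of s] K2[of s] cm[of s] by (auto simp: Q_def joint_def)
  have finJ: "finite ?J" by (rule finite_joint) simp
  have finQ: "finite Q" by (rule finite_subset[OF _ finite_permutations[of ?S]]) (auto simp: Q_def)
  have "b_coef lam = card {(s2, s3). s2 permutes ?S \<and> s3 permutes ?S \<and> s2 \<in> Kset m {#m#} \<and> s3 \<in> Kset m {#m#} \<and> s2 \<circ> s3 = w0}"
    unfolding b_coef_def Let_def assms(2) w0_def[symmetric]
    by (rule arg_cong[where f = card]) (auto simp: Kset_def)
  also have "\<dots> = card Q" unfolding Q_def by (rule card_factorizations[OF w0(1)])
  also have "\<dots> = (\<Sum>L\<in>?J. card {s \<in> Q. c s = L})"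
    unfolding card_eq_sum by (rule sum.group[OF finQ finJ, symmetric]) (use Q_eq in auto)
  also have "\<dots> = (\<Sum>L\<in>?J. 2 ^ m * fact m)"
  proof (rule sum.cong[OF refl])
    fix L assume L: "L \<in> ?J"
    then have "{s \<in> Q. c s = L} = {w. w permutes ?S \<and> w \<circ> ?f \<circ> inv w = L}"
      using Q_eq by (auto simp: c_def)
    then show "card {s \<in> Q. c s = L} = 2 ^ m * fact m"
      using card_conjugators[of m L] L by (simp add: joint_def)
  qed
  finally have "bt_coef lam = real (card ?J)" by (simp add: bt_coef_def assms(2))
  then show ?thesis using q type cA by blast
qed

section \<open>The recursion for the coefficients\<close>

lemma part_positive:
  assumes "\<forall>x\<in>#lam. x > 0" "k \<in># lam" "sum_mset lam = n + 1"
  shows "1 < k \<Longrightarrow> (\<forall>x\<in>#part_down1 k lam. x > 0) \<and> sum_mset (part_down1 k lam) = n"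
    and "d \<in> {1..k - 2} \<Longrightarrow> (\<forall>x\<in>#part_up (k - 1 - d) d lam. x > 0) \<and> sum_mset (part_up (k - 1 - d) d lam) = n"
    and "l \<in># lam - {#k#} \<Longrightarrow> (\<forall>x\<in>#part_down2 k l lam. x > 0) \<and> sum_mset (part_down2 k l lam) = n"
proof -
  obtain lam' where lam: "lam = add_mset k lam'" using assms(2) by (metis multi_member_split)
  have s: "sum_mset lam' + k = n + 1" and pos: "\<forall>x\<in>#lam'. x > 0" "k > 0" using assms lam by auto
  show "(\<forall>x\<in>#part_down1 k lam. x > 0) \<and> sum_mset (part_down1 k lam) = n" if "1 < k"
    using that s pos by (auto simp: part_down1_def lam)
  show "(\<forall>x\<in>#part_up (k - 1 - d) d lam. x > 0) \<and> sum_mset (part_up (k - 1 - d) d lam) = n" if "d \<in> {1..k - 2}"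
  proof -
    have "k - 1 - d + d + 1 = k" using that by auto
    then have "part_up (k - 1 - d) d lam = add_mset d (add_mset (k - 1 - d) lam')"
      unfolding part_up_def lam by (simp only:) simp
    then show ?thesis using that s pos(1) by auto
  qed
  show "(\<forall>x\<in>#part_down2 k l lam. x > 0) \<and> sum_mset (part_down2 k l lam) = n" if "l \<in># lam - {#k#}"
  proof -
    have "l \<in># lam'" using that unfolding lam by simp
    then obtain mu where mu: "lam' = add_mset l mu" by (metis multi_member_split)
    have "part_down2 k l lam = add_mset (k + l - 1) mu" unfolding part_down2_def lam mu by simp
    then show ?thesis using s pos unfolding mu by auto
  qed
qed

theorem theorem5:
  fixes lam :: "nat multiset" and n k :: nat
  assumes "n \<ge> 1"
    and "\<forall>x \<in># lam. x > 0"
    and "sum_mset lam = n + 1"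
    and "k \<in># lam"
  shows "(bt_coef lam = real (k - 1) * bt_coef (part_down1 k lam)
           + (\<Sum>d = 1..k - 2. bt_coef (part_up (k - 1 - d) d lam))
           + 2 * (\<Sum>l \<in># lam - {#k#}. real l * bt_coef (part_down2 k l lam)))
         \<and> (c_coef lam = (\<Sum>d = 1..k - 2. c_coef (part_up (k - 1 - d) d lam))
           + (\<Sum>l \<in># lam - {#k#}. l * c_coef (part_down2 k l lam)))"
proof
  note parts = part_positive[OF assms(2,4,3)]
  obtain F where F: "\<And>S A M N. coloured_matchings S A M N \<Longrightarrow> card A = n \<Longrightarrow>
      card (joint unrestricted S M N) = F (cycle_type (M \<circ> N) A)"
    using unrestricted_depends_on_type[OF assms(1)] by blast
  \<comment> \<open>Evaluating \<open>F\<close> on one representing pair identifies it with the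
    coefficient, but only on partitions of \<open>n\<close>; each argument in the recursion has to
    be shown to be one.\<close>
  have bF: "bt_coef mu = real (F mu)" if "(\<forall>x\<in>#mu. x > 0) \<and> sum_mset mu = n" for mu
  proof -
    from that have mu: "\<forall>x\<in>#mu. x > 0" "sum_mset mu = n" by auto
    obtain S A M N where "coloured_matchings S A M N" "card A = n" "cycle_type (M \<circ> N) A = mu"
      "bt_coef mu = real (card (joint unrestricted S M N))"
      using bt_coef_eq_card_joint[OF mu assms(1)] by auto
    then show ?thesis using F[of S A M N] by simp
  qed
  obtain S A M N where q: "coloured_matchings S A M N" and A: "card A = Suc n" "cycle_type (M \<circ> N) A = lam"
    and b: "bt_coef lam = real (card (joint unrestricted S M N))"
    using bt_coef_eq_card_joint[OF assms(2,3)] by auto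
  interpret coloured_matchings S A M N by (rule q)
  have "k \<in># cycle_type p A" using assms(4) A(2) by simp
  then obtain x where x: "x \<in> A" "card (orbit p x) = k" by (rule part_orbit)
  have "bt_coef lam = real (cut_join_unoriented F k lam)"
    using card_joint_unrestricted[OF x(1) A(1) assms(1) F] x(2) A(2) b by simp
  also have "\<dots> = real (k - 1) * bt_coef (part_down1 k lam)
      + (\<Sum>d = 1..k - 2. bt_coef (part_up (k - 1 - d) d lam))
      + 2 * (\<Sum>l \<in># lam - {#k#}. real l * bt_coef (part_down2 k l lam))"
  proof -
    \<comment> \<open>For \<open>k = 1\<close> the factor \<open>k - 1\<close> vanishes on both
      sides.\<close>
    have "real (k - 1) * bt_coef (part_down1 k lam) = real ((k - 1) * F (part_down1 k lam))"
    proof (cases "1 < k")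
      case True
      then show ?thesis by (simp only: bF[OF parts(1)] of_nat_mult)
    qed simp
    moreover have "(\<Sum>d = 1..k - 2. bt_coef (part_up (k - 1 - d) d lam)) = real (\<Sum>d = 1..k - 2. F (part_up (k - 1 - d) d lam))"
      unfolding of_nat_sum by (rule sum.cong[OF refl], rule bF[OF parts(2)])
    moreover have "(\<Sum>l \<in># lam - {#k#}. real l * bt_coef (part_down2 k l lam)) = real (\<Sum>l \<in># lam - {#k#}. l * F (part_down2 k l lam))"
    proof -
      have "real (sum_mset X) = sum_mset (image_mset real X)" for X by (induction X) auto
      then have "real (\<Sum>l \<in># lam - {#k#}. l * F (part_down2 k l lam)) = (\<Sum>l \<in># lam - {#k#}. real (l * F (part_down2 k l lam)))"
        by (simp only: image_mset.compositionality comp_def)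
      also have "\<dots> = (\<Sum>l \<in># lam - {#k#}. real l * bt_coef (part_down2 k l lam))"
        by (rule arg_cong[where f = sum_mset], rule image_mset_cong) (simp only: bF[OF parts(3)] of_nat_mult)
      finally show ?thesis by (rule sym)
    qed
    ultimately show ?thesis unfolding cut_join_unoriented_def by (simp only: of_nat_add of_nat_mult of_nat_numeral)
  qed
  finally show "bt_coef lam = real (k - 1) * bt_coef (part_down1 k lam)
      + (\<Sum>d = 1..k - 2. bt_coef (part_up (k - 1 - d) d lam))
      + 2 * (\<Sum>l \<in># lam - {#k#}. real l * bt_coef (part_down2 k l lam))" .
next
  note parts = part_positive[OF assms(2,4,3)]
  obtain F where F: "\<And>S A M N. coloured_matchings S A M N \<Longrightarrow> card A = n \<Longrightarrow>
      card (joint (opposite A) S M N) = F (cycle_type (M \<circ> N) A)"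
    using opposite_depends_on_type[OF assms(1)] by blast
  have cF: "c_coef mu = F mu" if "(\<forall>x\<in>#mu. x > 0) \<and> sum_mset mu = n" for mu
  proof -
    from that have mu: "\<forall>x\<in>#mu. x > 0" "sum_mset mu = n" by auto
    obtain S A M N where "coloured_matchings S A M N" "card A = n" "cycle_type (M \<circ> N) A = mu"
      "c_coef mu = card (joint (opposite A) S M N)"
      using c_coef_eq_card_joint[OF mu assms(1)] by auto
    then show ?thesis using F[of S A M N] by simp
  qed
  obtain S A M N where q: "coloured_matchings S A M N" and A: "card A = Suc n" "cycle_type (M \<circ> N) A = lam"
    and c: "c_coef lam = card (joint (opposite A) S M N)"
    using c_coef_eq_card_joint[OF assms(2,3)] by auto
  interpret coloured_matchings S A M N by (rule q)
  have "k \<in># cycle_type p A" using assms(4) A(2) by simp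
  then obtain x where x: "x \<in> A" "card (orbit p x) = k" by (rule part_orbit)
  have "c_coef lam = cut_join F k lam"
    using card_joint_opposite[OF x(1) A(1) assms(1) F] x(2) A(2) c by simp
  also have "\<dots> = (\<Sum>d = 1..k - 2. c_coef (part_up (k - 1 - d) d lam))
      + (\<Sum>l \<in># lam - {#k#}. l * c_coef (part_down2 k l lam))"
  proof -
    have "(\<Sum>d = 1..k - 2. c_coef (part_up (k - 1 - d) d lam)) = (\<Sum>d = 1..k - 2. F (part_up (k - 1 - d) d lam))"
      by (rule sum.cong[OF refl], rule cF[OF parts(2)])
    moreover have "(\<Sum>l \<in># lam - {#k#}. l * c_coef (part_down2 k l lam)) = (\<Sum>l \<in># lam - {#k#}. l * F (part_down2 k l lam))"
      by (rule arg_cong[where f = sum_mset], rule image_mset_cong) (simp only: cF[OF parts(3)])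
    ultimately show ?thesis unfolding cut_join_def by (simp only:)
  qed
  finally show "c_coef lam = (\<Sum>d = 1..k - 2. c_coef (part_up (k - 1 - d) d lam))
      + (\<Sum>l \<in># lam - {#k#}. l * c_coef (part_down2 k l lam))" .
qed

end
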